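(* Let $\mathcal K$ be an oriented virtual knot and $p$ an oriented parity with coefficients in an abelian group $A$ on the diagrams of $\mathcal K$. Let $\delta_D$ be the parity cycle of $p$, and for every diagram $D$ of $\mathcal K$ define $\pi_D\colon\mathcal V(D)\to A$ by $$\pi_D(v)=\delta_{NE}-\delta_{SW}=\delta_{SE}-\delta_{NW},$$ where $\delta_{SW},\delta_{SE}$ and $\delta_{NW},\delta_{NE}$ are the values of $\delta_D$ on the incoming and outgoing arcs at $v$ (notation of the context). Then: (1) the family of maps $\pi$ is a quasi-index on the diagrams of $\mathcal K$; (2) for any diagram $D$ of $\mathcal K$ there is a unique element $\rho(D)\in A$ such that $$\delta_D=\sum_{v\in\mathcal V(D)}\pi_D(v)\cdot D^r_v+\rho(D)\cdot D\in H_1(D,A).$$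
   Context: Diagrams. A virtual knot diagram $D$ is a generic oriented closed curve in the plane whose double points are marked classical (with over/under information) or virtual. A virtual knot $\mathcal K$ is a class of diagrams modulo isotopy, classical Reidemeister moves R1, R2, R3 and detour moves (replacing a path containing only virtual crossings by another path with the same ends containing only virtual crossings). $\mathcal V(D)$ is the set of classical crossings; $\mathcal A(D)$ is the set of arcs, i.e. pieces of $D$ between consecutive classical crossings (one closed arc if there are no classical crossings). A move $f\colon D\to D'$ induces a partial bijection $f_*\colon\mathcal V(D)\to\mathcal V(D')$ between surviving crossings. Local picture. Draw a classical crossing $v$ with both strands directed upward: the incoming arcs are SW, SE, the outgoing ones NW, NE, and the strands run SW$\to$NE and SE$\to$NW. The oriented smoothing at $v$ splits $D$ into the left half $D^l_v$ (leaving $v$ along NW, returning along SW) and the right half $D^r_v$ (leaving along NE, returning along SE). If a region (triangle) $\Delta$ has a corner at $v$, then $\epsilon_\Delta(v)=+1$ if $\Delta$ lies to the left or right of $v$ (between SW and NW, or between SE and NE) and $\epsilon_\Delta(v)=-1$ if it lies above or below $v$. Chains. $C_1(D,A)$ is the group of $A$-linear combinations of arcs, i.e. 1-chains of the graph with vertices $\mathcal V(D)$ and edges $\mathcal A(D)$ oriented along $D$; $H_1(D,A)$ is its subgroup of 1-cycles. $D$, $D^l_v$, $D^r_v$ are viewed as integral 1-cycles. Oriented parity. A family of maps $p_D\colon\mathcal V(D)\to A$ for all diagrams $D$ of $\mathcal K$ such that: (P0) $p_D(v)=p_{D'}(f_*(v))$ for every move $f\colon D\to D'$ and every $v$ for which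 $f_*(v)$ exists; (P1) $p_D(v)=0$ if $v$ disappears in a decreasing R1; (P2) $p_D(v_1)+p_D(v_2)=0$ if $v_1,v_2$ disappear in a decreasing R2; (P3+) $\sum_{i=1}^3\epsilon_\Delta(v_i)p_D(v_i)=0$ if $v_1,v_2,v_3$ are the vertices of the disappearing triangle $\Delta$ of an R3. Parity cycle. For $a\in\mathcal A(D)$ take two disjoint subsegments of $a$, bring them by detour moves side by side, parallel and in the same direction, and apply an increasing R2 to them. Let $v$ be the new crossing at which both strands enter the new bigon. Then $\delta_a$ is the value of $p$ at $v$ (it does not depend on the choices), and $\delta_D=\sum_{a\in\mathcal A(D)}\delta_a\cdot a$. It is known to be a 1-cycle. Quasi-index. A family of maps $\pi_D\colon\mathcal V(D)\to A$ for all diagrams $D$ of $\mathcal K$ such that: (Q0) for any Reidemeister move $f\colon D\to D'$ and any crossing $v\in\mathcal V(D)$ which does not take part in the move, $\pi_D(v)=\pi_{D'}(f_*(v))$; (Q2) $\pi_D(v_1)=\pi_D(v_2)$ for any $v_1,v_2\in\mathcal V(D)$ to which a decreasing R2 can be applied; (Q3) if $v_1,v_2,v_3\in\mathcal V(D)$ take part in an R3 move $f\colon D\to D'$ with disappearing triangle $\Delta$, then there is $\lambda(f)\in A$ with $\pi_{D'}(f_*(v_i))=\pi_D(v_i)+\epsilon_\Delta(v_i)\lambda(f)$, $i=1,2,3$. *)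

theory Defs
  imports Main "HOL-Combinatorics.Transposition"
begin

section \<open>Virtual knot diagrams\<close>

text \<open>
  A virtual diagram is taken up to plane isotopy and detour moves, i.e. it is given by what remains
  of a plane diagram when its virtual crossings are forgotten: the cyclic sequence of passages
  through classical crossings, and at each classical crossing the planar position of the two strands
  and the over/under information (a signed Gauss diagram). Every such datum comes from a plane
  diagram with virtual crossings, unique up to isotopy and detour moves. The remaining artefacts,
  the names of the crossings and the starting point of the reading, are absorbed by the
  isomorphisms below, which are among the moves.

  A crossing is drawn with both strands directed upwards, so that its strands run from SW to NE
  and from SE to NW.
\<close>

datatype leg = SW | SE | NW | NE

datatype strand = SWNE | SENW

fun strand_of :: "leg \<Rightarrow> strand" where
  "strand_of SW = SWNE" | "strand_of NE = SWNE" | "strand_of SE = SENW" | "strand_of NW = SENW"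

fun other :: "strand \<Rightarrow> strand" where
  "other SWNE = SENW" | "other SENW = SWNE"

definition incoming :: "leg \<Rightarrow> bool" where
  "incoming l \<longleftrightarrow> l \<in> {SW, SE}"

fun clockwise :: "leg \<Rightarrow> leg" where
  "clockwise NW = NE" | "clockwise NE = SE" | "clockwise SE = SW" | "clockwise SW = NW"

type_synonym passage = "nat \<times> strand"

text \<open>
  \<open>code D\<close> lists the passages met when travelling once along the oriented curve; \<open>over D v\<close> is the
  upper strand at the crossing \<open>v\<close> (so \<open>v\<close> is a positive crossing iff it is \<open>SWNE\<close>).
\<close>

record diagram =
  code :: "passage list"
  over :: "nat \<Rightarrow> strand"

definition crossings :: "diagram \<Rightarrow> nat set" where
  "crossings D = fst ` set (code D)"

definition wf_diagram :: "diagram \<Rightarrow> bool" where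
  "wf_diagram D \<longleftrightarrow> distinct (code D) \<and> set (code D) = crossings D \<times> UNIV"

text \<open>
  Arc number \<open>i\<close> starts at the passage \<open>code D ! i\<close> and ends at the (cyclically) next one; without
  crossings, number 0 is the single closed arc.
\<close>

definition arcs :: "diagram \<Rightarrow> nat set" where
  "arcs D = {..<max 1 (length (code D))}"

definition pos :: "diagram \<Rightarrow> passage \<Rightarrow> nat" where
  "pos D x = (THE i. i < length (code D) \<and> code D ! i = x)"

definition leg_arc :: "diagram \<Rightarrow> nat \<Rightarrow> leg \<Rightarrow> nat" where
  "leg_arc D v l =
     (if incoming l
      then (pos D (v, strand_of l) + length (code D) - 1) mod length (code D)
      else pos D (v, strand_of l))"


section \<open>Regions and moves\<close>

definition follows :: "diagram \<Rightarrow> passage \<Rightarrow> passage \<Rightarrow> bool" where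
  "follows D x y \<longleftrightarrow>
     (\<exists>i < length (code D). code D ! i = x \<and> code D ! (Suc i mod length (code D)) = y)"

text \<open>
  A corner \<open>(v, l)\<close> is the quadrant at the crossing \<open>v\<close> between the leg \<open>l\<close> and the next leg
  clockwise. \<open>joined\<close>: some arc (in either direction) connects the two legs. \<open>side\<close>: an arc leads
  from the first corner to the second one in the counterclockwise traversal of the boundary of a
  region, that is, with the region and its corners on the left. A closed sequence of sides thus bounds a
  region; such a region of a Gauss diagram becomes a genuine disc free of other strands after
  suitable detour moves.
\<close>

type_synonym corner = "nat \<times> leg"

definition joined :: "diagram \<Rightarrow> corner \<Rightarrow> corner \<Rightarrow> bool" where
  "joined D = (\<lambda>(v, l) (w, m).
     \<not> incoming l \<and> incoming m \<and> follows D (v, strand_of l) (w, strand_of m) \<or>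
     incoming l \<and> \<not> incoming m \<and> follows D (w, strand_of m) (v, strand_of l))"

definition side :: "diagram \<Rightarrow> corner \<Rightarrow> corner \<Rightarrow> bool" where
  "side D x y \<longleftrightarrow> joined D (fst x, clockwise (snd x)) y"

definition side_start :: "corner \<Rightarrow> passage" where
  "side_start x = (fst x, strand_of (clockwise (snd x)))"

definition side_end :: "corner \<Rightarrow> passage" where
  "side_end x = (fst x, strand_of (snd x))"

definition is_over :: "diagram \<Rightarrow> passage \<Rightarrow> bool" where
  "is_over D x \<longleftrightarrow> over D (fst x) = snd x"

text \<open>The sign \<open>\<epsilon>\<^sub>\<Delta>(v)\<close> (times \<open>a\<close>) of a region with the corner \<open>x\<close> at \<open>v\<close>: the left corner is
  \<open>(v, SW)\<close>, the right one \<open>(v, NE)\<close>.\<close>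

definition eps :: "corner \<Rightarrow> 'a::ab_group_add \<Rightarrow> 'a" where
  "eps x a = (if snd x = SW \<or> snd x = NE then a else - a)"

definition deletes :: "diagram \<Rightarrow> nat set \<Rightarrow> diagram \<Rightarrow> bool" where
  "deletes D S D' \<longleftrightarrow> code D' = filter (\<lambda>x. fst x \<notin> S) (code D) \<and>
     (\<forall>v \<in> crossings D'. over D' v = over D v)"

text \<open>Decreasing first move at a monogon with vertex \<open>v\<close>.\<close>

definition R1_dec :: "diagram \<Rightarrow> nat \<Rightarrow> diagram \<Rightarrow> bool" where
  "R1_dec D v D' \<longleftrightarrow> wf_diagram D \<and> wf_diagram D' \<and>
     (\<exists>l. side D (v, l) (v, l)) \<and> deletes D {v} D'"

text \<open>Decreasing second move at a bigon with vertices \<open>v\<close> and \<open>w\<close>: one of its sides passes over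
  at both ends, or under at both ends, and hence the other side does the opposite.\<close>

definition R2_dec :: "diagram \<Rightarrow> nat \<Rightarrow> nat \<Rightarrow> diagram \<Rightarrow> bool" where
  "R2_dec D v w D' \<longleftrightarrow> wf_diagram D \<and> wf_diagram D' \<and> v \<noteq> w \<and>
     (\<exists>l m. side D (v, l) (w, m) \<and> side D (w, m) (v, l) \<and>
        (is_over D (side_start (v, l)) \<longleftrightarrow> is_over D (side_end (w, m)))) \<and>
     deletes D {v, w} D'"

text \<open>
  Third move at a triangle with corners \<open>x\<close>, \<open>y\<close>, \<open>z\<close>, listed counterclockwise. Each of the three
  strands then meets the other two in the opposite order, so the two passages at the ends of each
  side are exchanged. The strands can be ordered by height iff the three sides are not all
  over at their start and under at their end, nor all under at their start and over at their end.
\<close>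

definition R3 :: "diagram \<Rightarrow> corner \<Rightarrow> corner \<Rightarrow> corner \<Rightarrow> diagram \<Rightarrow> bool" where
  "R3 D x y z D' \<longleftrightarrow> wf_diagram D \<and> wf_diagram D' \<and>
     distinct [fst x, fst y, fst z] \<and> side D x y \<and> side D y z \<and> side D z x \<and>
     \<not> (is_over D (side_start x) = is_over D (side_start y) \<and>
        is_over D (side_start y) = is_over D (side_start z)) \<and>
     code D' = map (transpose (side_start x) (side_end y) \<circ>
                    transpose (side_start y) (side_end z) \<circ>
                    transpose (side_start z) (side_end x)) (code D) \<and>
     (\<forall>v \<in> crossings D. over D' v = over D v)"

definition diagram_iso :: "(nat \<Rightarrow> nat) \<Rightarrow> diagram \<Rightarrow> diagram \<Rightarrow> bool" where
  "diagram_iso g D D' \<longleftrightarrow> wf_diagram D \<and> wf_diagram D' \<and> inj_on g (crossings D) \<and>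
     (\<exists>k. code D' = rotate k (map (map_prod g id) (code D))) \<and>
     (\<forall>v \<in> crossings D. over D' (g v) = over D v)"

text \<open>
  \<open>move D D' f S\<close>: \<open>f\<close> is the induced partial bijection of crossings and \<open>S\<close> the set of crossings
  of \<open>D\<close> taking part in the move.
\<close>

inductive move :: "diagram \<Rightarrow> diagram \<Rightarrow> (nat \<Rightarrow> nat option) \<Rightarrow> nat set \<Rightarrow> bool" where
  iso: "diagram_iso g D D' \<Longrightarrow> move D D' (\<lambda>v. if v \<in> crossings D then Some (g v) else None) {}"
| R1_decreasing: "R1_dec D v D' \<Longrightarrow>
    move D D' (\<lambda>u. if u \<in> crossings D' then Some u else None) {v}"
| R1_increasing: "R1_dec D' v D \<Longrightarrow>
    move D D' (\<lambda>u. if u \<in> crossings D then Some u else None) {}"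
| R2_decreasing: "R2_dec D v w D' \<Longrightarrow>
    move D D' (\<lambda>u. if u \<in> crossings D' then Some u else None) {v, w}"
| R2_increasing: "R2_dec D' v w D \<Longrightarrow>
    move D D' (\<lambda>u. if u \<in> crossings D then Some u else None) {}"
| R3: "R3 D x y z D' \<Longrightarrow>
    move D D' (\<lambda>u. if u \<in> crossings D then Some u else None) {fst x, fst y, fst z}"

definition virtual_knot :: "diagram set \<Rightarrow> bool" where
  "virtual_knot K \<longleftrightarrow>
     (\<exists>D. wf_diagram D \<and> K = {D'. (\<lambda>E E'. \<exists>f S. move E E' f S)\<^sup>*\<^sup>* D D'})"


section \<open>Chains\<close>

type_synonym 'a chain = "nat \<Rightarrow> 'a"

definition C1 :: "diagram \<Rightarrow> 'a::ab_group_add chain set" where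
  "C1 D = {c. \<forall>a. a \<notin> arcs D \<longrightarrow> c a = 0}"

definition H1 :: "diagram \<Rightarrow> 'a::ab_group_add chain set" where
  "H1 D = {c \<in> C1 D. \<forall>v \<in> crossings D.
     c (leg_arc D v SW) + c (leg_arc D v SE) = c (leg_arc D v NW) + c (leg_arc D v NE)}"

text \<open>The chain \<open>x \<cdot> S\<close>, where the set \<open>S\<close> of arcs stands for the integral chain with
  coefficient 1 on \<open>S\<close> and 0 elsewhere. The integral cycles \<open>D\<close> and \<open>D\<^sup>r\<^sub>v\<close> are of this kind, given by
  \<open>arcs D\<close> and \<open>right_half D v\<close>.\<close>

definition times_chain :: "'a::ab_group_add \<Rightarrow> nat set \<Rightarrow> 'a chain" where
  "times_chain x S = (\<lambda>a. if a \<in> S then x else 0)"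

text \<open>The arcs met from leaving \<open>v\<close> along NE until the return to \<open>v\<close> along SE.\<close>

definition right_half :: "diagram \<Rightarrow> nat \<Rightarrow> nat set" where
  "right_half D v = (let n = length (code D); i = pos D (v, SWNE); j = pos D (v, SENW) in
     {(i + k) mod n |k. k < (j + n - i) mod n})"


section \<open>Oriented parities and quasi-indices\<close>

definition oriented_parity ::
  "diagram set \<Rightarrow> (diagram \<Rightarrow> nat \<Rightarrow> 'a::ab_group_add) \<Rightarrow> bool" where
  "oriented_parity K p \<longleftrightarrow>
     (\<forall>D \<in> K. \<forall>D' f S v w. move D D' f S \<longrightarrow> v \<in> crossings D \<longrightarrow> f v = Some w \<longrightarrow> p D v = p D' w) \<and>
     (\<forall>D \<in> K. \<forall>D' v. R1_dec D v D' \<longrightarrow> p D v = 0) \<and>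
     (\<forall>D \<in> K. \<forall>D' v w. R2_dec D v w D' \<longrightarrow> p D v + p D w = 0) \<and>
     (\<forall>D \<in> K. \<forall>D' x y z. R3 D x y z D' \<longrightarrow>
        eps x (p D (fst x)) + eps y (p D (fst y)) + eps z (p D (fst z)) = 0)"

definition quasi_index ::
  "diagram set \<Rightarrow> (diagram \<Rightarrow> nat \<Rightarrow> 'a::ab_group_add) \<Rightarrow> bool" where
  "quasi_index K \<pi> \<longleftrightarrow>
     (\<forall>D \<in> K. \<forall>D' f S v w. move D D' f S \<longrightarrow> v \<in> crossings D - S \<longrightarrow> f v = Some w \<longrightarrow>
        \<pi> D v = \<pi> D' w) \<and>
     (\<forall>D \<in> K. \<forall>D' v w. R2_dec D v w D' \<longrightarrow> \<pi> D v = \<pi> D w) \<and>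
     (\<forall>D \<in> K. \<forall>D' x y z. R3 D x y z D' \<longrightarrow>
        (\<exists>t. \<forall>c \<in> {x, y, z}. \<pi> D' (fst c) = \<pi> D (fst c) + eps c t))"

text \<open>
  \<open>self_R2 D a v D'\<close>: \<open>D'\<close> is obtained by an increasing second move on two disjoint subsegments of
  the arc \<open>a\<close>, placed side by side and codirected, and both strands enter the new bigon at \<open>v\<close>. Which
  subsegment lies to the left (encoded by \<open>s\<close>) and which one goes over is left open.
\<close>

definition self_R2 :: "diagram \<Rightarrow> nat \<Rightarrow> nat \<Rightarrow> diagram \<Rightarrow> bool" where
  "self_R2 D a v D' \<longleftrightarrow> (\<exists>w s. R2_dec D' v w D \<and>
     code D' = take (Suc a) (code D) @ [(v, s), (w, other s), (v, other s), (w, s)]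
                 @ drop (Suc a) (code D))"

text \<open>The value selected by \<open>THE\<close> does not depend on the choices in \<open>self_R2\<close> when \<open>p\<close> is an
  oriented parity.\<close>

definition parity_cycle :: "(diagram \<Rightarrow> nat \<Rightarrow> 'a::ab_group_add) \<Rightarrow> diagram \<Rightarrow> 'a chain" where
  "parity_cycle p D = (\<lambda>a. if a \<in> arcs D
     then (THE x. \<exists>v D'. self_R2 D a v D' \<and> x = p D' v) else 0)"

definition pi_of :: "(diagram \<Rightarrow> nat \<Rightarrow> 'a::ab_group_add) \<Rightarrow> diagram \<Rightarrow> nat \<Rightarrow> 'a" where
  "pi_of p D v = parity_cycle p D (leg_arc D v NE) - parity_cycle p D (leg_arc D v SW)"

end

theory Submission
  imports Defs
begin

text \<open>
  The theorem is a consequence of one relation between values of the parity on pairs of crossings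
  created by second moves. Let two segments of the curve be brought side by side by detour moves and
  cross twice. The value of the parity at the first new crossing does not change when further moves
  are made elsewhere, so it depends only on the two segments and on how they cross. Write \<open>R(i, j)\<close> for
  this value if the segments run in the same direction, and \<open>Q(i, j)\<close> if they run in opposite
  directions. When three segments cross pairwise in this way, the crossings can be arranged so that
  three of them bound a triangle, and the axiom for third moves becomes
  \<open>R(i, k) - R(i, j) = Q(j, k)\<close> (\<open>triangle_relation\<close>). Since the heights of three strands can be chosen
  with hardly any restriction, the values cannot depend on the heights (\<open>height_irrelevant\<close>). Three
  segments of the same arc give \<open>Q = 0\<close> there and show that \<open>R\<close> does not change when the two segments
  exchange sides. This is why the parity cycle is well defined (\<open>arc_value_pair_value\<close>,
  \<open>parity_cycle_eq\<close>).

  Next to a crossing \<open>v\<close>, a pair can be inserted on two legs in such a way that \<open>v\<close> and a new crossing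
  form a bigon. The axiom for second moves then expresses \<open>p v\<close> by \<open>R\<close> or \<open>Q\<close> of these legs, once for each
  quadrant. These four equations and the triangle relation imply that the coefficients of the incoming
  legs and those of the outgoing legs have the same sum (\<open>conservation\<close>), so the parity cycle is a
  cycle and both expressions for \<open>\<pi>\<close> agree.

  The coefficient of the cycle at a point away from a move is not affected by the move, because the
  inserted pair does not disturb it (\<open>arc_value_move\<close>). The quasi-index properties follow from this
  and conservation alone. At a bigon, the two outer parts of a strand merge into one arc after the move
  and hence have equal coefficients; together with the common inner arc this gives equal \<open>\<pi>\<close> at the two
  vertices (\<open>pi_bigon\<close>). At a triangle only the coefficients of the three sides change. The changes of
  \<open>\<pi>\<close> at the two ends of a side agree up to the signs \<open>\<epsilon>\<close>, and as adjacent sides share a corner, one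
  element \<open>\<lambda>\<close> serves all three (\<open>pi_triangle_side\<close>).

  Finally, at each passage through \<open>v\<close> the cycle jumps by \<open>\<pi> v\<close> or \<open>- \<pi> v\<close>, and so does the sum of
  the right halves with coefficients \<open>\<pi>\<close>. The difference is constant along the curve; its value at any
  one arc is \<open>\<rho>(D)\<close> (\<open>parity_cycle_decomposition\<close>).
\<close>

section \<open>Cyclic codes\<close>

lemma other_other [simp]: "other (other s) = s"
  by (cases s) auto

lemma other_neq [simp]: "other s \<noteq> s" "s \<noteq> other s"
  by (cases s; simp)+

lemma neq_strand_iff: "t \<noteq> s \<longleftrightarrow> t = other s"
  by (cases s; cases t; simp)

lemma other_eq_iff [simp]: "other s = other t \<longleftrightarrow> s = t"
  by (cases s; cases t; simp)

lemma ex_strand: "(\<exists>t. P t) \<longleftrightarrow> P SWNE \<or> P SENW"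
  by (metis strand.exhaust)

lemma ex_leg: "(\<exists>l. P l) \<longleftrightarrow> P SW \<or> P SE \<or> P NW \<or> P NE"
  by (metis leg.exhaust)

abbreviation dia :: "passage list \<Rightarrow> (nat \<Rightarrow> strand) \<Rightarrow> diagram" where
  "dia c ov \<equiv> \<lparr>code = c, over = ov\<rparr>"

lemma wf_diagram_iff:
  "wf_diagram D \<longleftrightarrow> distinct (code D) \<and>
     (\<forall>v t. (v, t) \<in> set (code D) \<longrightarrow> (v, other t) \<in> set (code D))"
proof
  assume "wf_diagram D"
  then show "distinct (code D) \<and> (\<forall>v t. (v, t) \<in> set (code D) \<longrightarrow> (v, other t) \<in> set (code D))"
    by (auto simp: wf_diagram_def)
next
  assume *: "distinct (code D) \<and> (\<forall>v t. (v, t) \<in> set (code D) \<longrightarrow> (v, other t) \<in> set (code D))"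
  have "(v, t') \<in> set (code D)" if "(v, t) \<in> set (code D)" for v t t'
    using * that by (cases "t' = t") (auto simp: neq_strand_iff)
  then show "wf_diagram D"
    using * by (force simp: wf_diagram_def crossings_def)
qed

lemma wf_passages: "wf_diagram D \<Longrightarrow> (v, t) \<in> set (code D) \<longleftrightarrow> v \<in> crossings D"
  by (auto simp: wf_diagram_def)

lemma follows_iff:
  "follows D a b \<longleftrightarrow> (\<exists>u w. code D = u @ a # b # w) \<or>
     (code D \<noteq> [] \<and> last (code D) = a \<and> hd (code D) = b)"
proof
  assume "follows D a b"
  then obtain i where i: "i < length (code D)" "code D ! i = a"
    "code D ! (Suc i mod length (code D)) = b"
    by (auto simp: follows_def)
  show "(\<exists>u w. code D = u @ a # b # w) \<or> (code D \<noteq> [] \<and> last (code D) = a \<and> hd (code D) = b)"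
  proof (cases "Suc i < length (code D)")
    case True
    then have "code D = take i (code D) @ a # b # drop (Suc (Suc i)) (code D)"
      using i by (metis Cons_nth_drop_Suc Suc_lessD append_take_drop_id mod_less)
    then show ?thesis by blast
  next
    case False
    then have "Suc i = length (code D)" using i by simp
    then show ?thesis using i
      by (metis diff_Suc_1 hd_conv_nth last_conv_nth length_0_conv mod_self nat.distinct(1))
  qed
next
  assume "(\<exists>u w. code D = u @ a # b # w) \<or> (code D \<noteq> [] \<and> last (code D) = a \<and> hd (code D) = b)"
  then show "follows D a b"
  proof
    assume "\<exists>u w. code D = u @ a # b # w"
    then obtain u w where "code D = u @ a # b # w" by blast
    then show ?thesis
      unfolding follows_def by (intro exI[of _ "length u"]) (simp add: nth_append)
  next
    assume "code D \<noteq> [] \<and> last (code D) = a \<and> hd (code D) = b"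
    then show ?thesis
      unfolding follows_def
      by (intro exI[of _ "length (code D) - 1"]) (auto simp: last_conv_nth simp flip: hd_conv_nth)
  qed
qed

lemma followsI: "code D = u @ a # b # w \<Longrightarrow> follows D a b"
  by (auto simp: follows_iff)

text \<open>
  The gap between \<open>A\<close> and \<open>B\<close> lies, on the closed curve, between the passages \<open>last (B @ A)\<close> and
  \<open>hd (B @ A)\<close>; an insertion there separates no other pair of neighbours. The rotated list
  \<open>B @ A\<close> covers the gap at the starting point of the reading as well.
\<close>

lemma follows_insert:
  assumes "follows D a b" "code D = A @ B" "code E = A @ W @ B"
    and "last (B @ A) \<noteq> a \<or> hd (B @ A) \<noteq> b"
  shows "follows E a b"
  using assms(1) unfolding follows_iff
proof
  assume "\<exists>u w. code D = u @ a # b # w"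
  then obtain u w where uw: "A @ B = u @ a # b # w" using assms(2) by auto
  have "\<exists>u w. code E = u @ a # b # w"
  proof (cases "length A \<le> length u")
    case True
    then obtain u' where "u = A @ u'" "B = u' @ a # b # w"
      using uw by (auto simp: append_eq_append_conv2)
    then have "code E = (A @ W @ u') @ a # b # w" using assms(3) by simp
    then show ?thesis by blast
  next
    case False
    then obtain v where v: "A = u @ v" "v \<noteq> []" "v @ B = a # b # w"
      using uw by (auto simp: append_eq_append_conv2)
    show ?thesis
    proof (cases "v = [a]")
      case True
      then show ?thesis using v assms(4) by simp
    next
      case False
      then obtain v' where "v = a # b # v'"
        using v by (cases v; cases "tl v") auto
      then have "code E = u @ a # b # v' @ W @ B" using v assms(3) by simp
      then show ?thesis by blast
    qed
  qed
  then show "(\<exists>u w. code E = u @ a # b # w) \<or> (code E \<noteq> [] \<and> last (code E) = a \<and> hd (code E) = b)"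
    by blast
next
  assume *: "code D \<noteq> [] \<and> last (code D) = a \<and> hd (code D) = b"
  then have "A \<noteq> []" "B \<noteq> []"
    using assms(2,4) by auto
  then show "(\<exists>u w. code E = u @ a # b # w) \<or> (code E \<noteq> [] \<and> last (code E) = a \<and> hd (code E) = b)"
    using * assms(2,3) by simp
qed

section \<open>Monogons, bigons and triangles\<close>

text \<open>
  The two sides of a bigon join \<open>v\<close> and \<open>w\<close>, and since its corners are quadrants, a strand that is
  SW-NE at one of them is SE-NW at the other. So the planar condition says only how the four
  passages follow each other: both sides lead from \<open>v\<close> to \<open>w\<close>, or they are opposite, or both lead
  from \<open>w\<close> to \<open>v\<close>.
\<close>

definition bigon :: "diagram \<Rightarrow> nat \<Rightarrow> nat \<Rightarrow> bool" where
  "bigon D v w \<longleftrightarrow>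
     (\<exists>t. follows D (v, t) (w, other t) \<and>
        (follows D (v, other t) (w, t) \<or> follows D (w, t) (v, other t))) \<or>
     (\<exists>t. follows D (w, t) (v, other t) \<and> follows D (w, other t) (v, t))"

lemma R1_dec_iff:
  "R1_dec D v D' \<longleftrightarrow> wf_diagram D \<and> wf_diagram D' \<and>
     (\<exists>t. follows D (v, t) (v, other t)) \<and> deletes D {v} D'"
  unfolding R1_dec_def side_def joined_def ex_leg ex_strand
  by (auto simp: incoming_def)

lemma R2_dec_iff:
  "R2_dec D v w D' \<longleftrightarrow> wf_diagram D \<and> wf_diagram D' \<and> v \<noteq> w \<and> bigon D v w \<and>
     over D w = other (over D v) \<and> deletes D {v, w} D'"
proof -
  have ov: "over D u = SENW \<longleftrightarrow> over D u \<noteq> SWNE" "over D w = other (over D v) \<longleftrightarrow> (over D v = SWNE \<longleftrightarrow> over D w \<noteq> SWNE)" for u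
    by (cases "over D u"; cases "over D v"; cases "over D w"; simp)+
  have "(\<exists>l m. side D (v, l) (w, m) \<and> side D (w, m) (v, l) \<and>
        (is_over D (side_start (v, l)) \<longleftrightarrow> is_over D (side_end (w, m)))) \<longleftrightarrow>
      bigon D v w \<and> over D w = other (over D v)"
    unfolding bigon_def side_def joined_def ex_leg ex_strand is_over_def side_start_def side_end_def
      ov(2)
    by (simp add: incoming_def ov(1)) blast
  then show ?thesis unfolding R2_dec_def by blast
qed


lemma wf_filter:
  "wf_diagram D \<Longrightarrow> code E = filter (\<lambda>x. fst x \<notin> S) (code D) \<Longrightarrow> wf_diagram E"
  by (auto simp: wf_diagram_iff)

lemma R2_decI:
  assumes "wf_diagram D" "v \<noteq> w" "bigon D v w" "over D w = other (over D v)"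
    and "code D' = filter (\<lambda>x. fst x \<notin> {v, w}) (code D)"
    and "\<And>u. u \<in> crossings D' \<Longrightarrow> over D' u = over D u"
  shows "R2_dec D v w D'"
  unfolding R2_dec_iff deletes_def using assms wf_filter[OF assms(1,5)] by blast

lemma set_map_transpose:
  "a \<in> set c \<Longrightarrow> b \<in> set c \<Longrightarrow> set (map (transpose a b) c) = set c"
  by (metis list.set_map transpose_image_eq)

lemma wf_map_transpose:
  assumes "wf_diagram D" "{a, b, c, d, e, f} \<subseteq> set (code D)"
    and "code D' = map (transpose a b \<circ> transpose c d \<circ> transpose e f) (code D)"
  shows "wf_diagram D'" and "set (code D') = set (code D)"
proof -
  let ?c1 = "map (transpose e f) (code D)" and ?c2 = "map (transpose c d) (map (transpose e f) (code D))"
  have code: "code D' = map (transpose a b) ?c2"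
    using assms(3) by simp
  have s1: "set ?c1 = set (code D)" by (rule set_map_transpose) (use assms(2) in auto)
  have s2: "set ?c2 = set (code D)"
    using set_map_transpose[of c ?c1 d] assms(2) s1 by simp
  show s3: "set (code D') = set (code D)"
    unfolding code using set_map_transpose[of a ?c2 b] assms(2) s2 by simp
  have "inj_on (transpose a b \<circ> transpose c d \<circ> transpose e f) A" for A
    by (intro comp_inj_on inj_on_transpose)
  then have "distinct (code D')"
    using assms(1,3) by (auto simp: distinct_map wf_diagram_iff)
  then show "wf_diagram D'"
    using assms(1) s3 by (simp add: wf_diagram_iff)
qed

lemma follows_set: "follows D a b \<Longrightarrow> a \<in> set (code D) \<and> b \<in> set (code D)"
  unfolding follows_iff by auto

lemma side_set: "side D x y \<Longrightarrow> side_start x \<in> set (code D) \<and> side_end y \<in> set (code D)"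
  unfolding side_def joined_def side_start_def side_end_def
  by (auto dest: follows_set split: prod.splits)

text \<open>
  The exchange of passages leads to a diagram again, because each of them changes places with another
  passage of the same code.
\<close>

lemma R3_exists:
  assumes "wf_diagram D" "distinct [fst x, fst y, fst z]" "side D x y" "side D y z" "side D z x"
    and "\<not> (is_over D (side_start x) = is_over D (side_start y) \<and>
        is_over D (side_start y) = is_over D (side_start z))"
  obtains D' where "R3 D x y z D'"
proof -
  let ?f = "transpose (side_start x) (side_end y) \<circ> transpose (side_start y) (side_end z) \<circ>
      transpose (side_start z) (side_end x)"
  define D' where "D' = dia (map ?f (code D)) (over D)"
  have "wf_diagram D'"
    by (rule wf_map_transpose(1)[OF assms(1), where D' = D' and a = "side_start x" and b = "side_end y"
        and c = "side_start y" and d = "side_end z" and e = "side_start z" and f = "side_end x"])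
       (use side_set[OF assms(3)] side_set[OF assms(4)] side_set[OF assms(5)] in \<open>simp_all add: D'_def\<close>)
  then have "R3 D x y z D'"
    unfolding R3_def using assms by (simp only: D'_def diagram.simps) blast
  then show ?thesis ..
qed

section \<open>Inserting pairs of crossings\<close>

text \<open>
  A template is a code in which the places for later insertions are marked by numbered slots
  (\<open>Inr k\<close>). Filling all slots but a few with the empty word describes insertions at any chosen
  points of the curve, whatever the order in which it runs through them and whether or not they
  lie on one arc.
\<close>

type_synonym template = "(passage + nat) list"

definition fill :: "(nat \<Rightarrow> passage list) \<Rightarrow> template \<Rightarrow> passage list" where
  "fill \<sigma> T = concat (map (case_sum (\<lambda>x. [x]) \<sigma>) T)"

lemma fill_simps [simp]:
  "fill \<sigma> [] = []"
  "fill \<sigma> (Inl x # T) = x # fill \<sigma> T"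
  "fill \<sigma> (Inr k # T) = \<sigma> k @ fill \<sigma> T"
  "fill \<sigma> (T @ T') = fill \<sigma> T @ fill \<sigma> T'"
  "fill \<sigma> (map Inl A) = A"
  by (auto simp: fill_def map_idI comp_def)

lemma set_fill: "set (fill \<sigma> T) = {x. Inl x \<in> set T} \<union> (\<Union>k \<in> {k. Inr k \<in> set T}. set (\<sigma> k))"
proof (induction T)
  case (Cons z T)
  then show ?case by (cases z) auto
qed simp

lemma distinct_fill:
  assumes "distinct T" "\<And>k. Inr k \<in> set T \<Longrightarrow> distinct (\<sigma> k)"
    and "\<And>k l. Inr k \<in> set T \<Longrightarrow> Inr l \<in> set T \<Longrightarrow> k \<noteq> l \<Longrightarrow> set (\<sigma> k) \<inter> set (\<sigma> l) = {}"
    and "\<And>k x. Inr k \<in> set T \<Longrightarrow> Inl x \<in> set T \<Longrightarrow> x \<notin> set (\<sigma> k)"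
  shows "distinct (fill \<sigma> T)"
  using assms
proof (induction T)
  case (Cons z T)
  then have "distinct (fill \<sigma> T)" by simp
  then show ?case using Cons.prems by (cases z) (auto simp: set_fill)
qed simp

lemma filter_fill:
  "(\<And>x. Inl x \<in> set T \<Longrightarrow> P x) \<Longrightarrow> filter P (fill \<sigma> T) = fill (\<lambda>k. filter P (\<sigma> k)) T"
proof (induction T)
  case (Cons z T)
  then show ?case by (cases z) auto
qed simp

lemma map_fill:
  "(\<And>x. Inl x \<in> set T \<Longrightarrow> f x = x) \<Longrightarrow> map f (fill \<sigma> T) = fill (\<lambda>k. map f (\<sigma> k)) T"
proof (induction T)
  case (Cons z T)
  then show ?case by (cases z) auto
qed simp

lemma follows_fill:
  assumes "Inr k \<in> set T" "\<sigma> k = u @ a # b # w" "code E = fill \<sigma> T"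
  shows "follows E a b"
proof -
  obtain P Q where "T = P @ Inr k # Q" using assms(1) by (meson split_list)
  then have "code E = (fill \<sigma> P @ u) @ a # b # (w @ fill \<sigma> Q)" using assms(2,3) by simp
  then show ?thesis by (rule followsI)
qed

definition template_of :: "diagram \<Rightarrow> template \<Rightarrow> bool" where
  "template_of D T \<longleftrightarrow> distinct T \<and> fill (\<lambda>_. []) T = code D"

lemma template_base: "template_of D T \<Longrightarrow> Inl x \<in> set T \<longleftrightarrow> x \<in> set (code D)"
  unfolding template_of_def using set_fill[of "\<lambda>_. []" T] by auto

text \<open>
  An increasing second move that makes the segments at the slots \<open>i\<close> and \<open>j\<close> cross at \<open>x\<close> and \<open>y\<close>.
  The segment \<open>i\<close> meets \<open>x\<close> first; it is the SW-NE or the SE-NW strand there according to \<open>s\<close>.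
  The segment \<open>j\<close> runs in the same direction if \<open>par\<close> holds and in the opposite one otherwise.
\<close>

definition pair_word ::
  "bool \<Rightarrow> nat \<Rightarrow> nat \<Rightarrow> strand \<Rightarrow> nat \<Rightarrow> nat \<Rightarrow> nat \<Rightarrow> passage list" where
  "pair_word par i j s x y = (\<lambda>_. [])(i := [(x, s), (y, other s)],
     j := (if par then [(x, other s), (y, s)] else [(y, s), (x, other s)]))"

text \<open>
  Three segments that cross in pairs: \<open>i\<close> and \<open>j\<close> run in the same direction and cross at \<open>a\<close>, \<open>a'\<close>,
  so do \<open>i\<close> and \<open>k\<close> with crossings \<open>b\<close>, \<open>b'\<close>, while \<open>j\<close> and \<open>k\<close> run in opposite directions and cross
  at \<open>c\<close>, \<open>c'\<close>. The order on each segment keeps the two crossings of every pair adjacent, so that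
  each pair can be removed by itself, and makes \<open>a'\<close>, \<open>b\<close>, \<open>c\<close> the corners of a triangle. With three
  codirected pairs both requirements could not be met.
\<close>

definition triple_word ::
  "nat \<Rightarrow> nat \<Rightarrow> nat \<Rightarrow> strand \<Rightarrow> nat \<Rightarrow> nat \<Rightarrow> nat \<Rightarrow> nat \<Rightarrow> nat \<Rightarrow> nat \<Rightarrow> nat \<Rightarrow> passage list" where
  "triple_word i j k s a a' b b' c c' = (\<lambda>_. [])(
     i := [(a, s), (a', other s), (b, s), (b', other s)],
     j := [(a, other s), (a', s), (c, s), (c', other s)],
     k := [(c', s), (c, other s), (b, other s), (b', s)])"

definition fresh :: "diagram \<Rightarrow> nat" where
  "fresh D = Suc (Max (insert 0 (crossings D)))"

lemma fresh_notin: "fresh D + k \<notin> crossings D"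
proof
  assume "fresh D + k \<in> crossings D"
  moreover have "finite (crossings D)" by (simp add: crossings_def)
  ultimately have "fresh D + k \<le> Max (insert 0 (crossings D))" by simp
  then show False by (simp add: fresh_def)
qed

lemma Suc_fresh_notin: "fresh D \<notin> crossings D" "Suc (fresh D) \<notin> crossings D"
  using fresh_notin[of D 0] fresh_notin[of D 1] by auto

lemma code_crossings: "(u, t) \<in> set (code D) \<Longrightarrow> u \<in> crossings D"
  by (force simp: crossings_def)

lemma wf_fill:
  assumes D: "wf_diagram D" "template_of D T"
    and E: "code E = fill \<sigma> T"
    and dist: "\<And>k. Inr k \<in> set T \<Longrightarrow> distinct (\<sigma> k)"
    and disj: "\<And>k l. Inr k \<in> set T \<Longrightarrow> Inr l \<in> set T \<Longrightarrow> k \<noteq> l \<Longrightarrow> set (\<sigma> k) \<inter> set (\<sigma> l) = {}"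
    and new: "\<And>k u t. Inr k \<in> set T \<Longrightarrow> (u, t) \<in> set (\<sigma> k) \<Longrightarrow> u \<notin> crossings D"
    and twice: "\<And>k u t. Inr k \<in> set T \<Longrightarrow> (u, t) \<in> set (\<sigma> k) \<Longrightarrow>
                 \<exists>l. Inr l \<in> set T \<and> (u, other t) \<in> set (\<sigma> l)"
  shows "wf_diagram E"
proof -
  note base = template_base[OF D(2)]
  have "distinct (code E)"
    unfolding E
    by (rule distinct_fill) (use D dist disj new in \<open>auto simp: base template_of_def dest: code_crossings\<close>)
  moreover have "(u, other t) \<in> set (code E)" if "(u, t) \<in> set (code E)" for u t
    using that D(1) twice unfolding E set_fill base by (auto simp: wf_diagram_iff) 
  ultimately show ?thesis by (auto simp: wf_diagram_iff)
qed

lemma wf_pair: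
  assumes "wf_diagram D" "template_of D T" "i \<noteq> j" "Inr i \<in> set T" "Inr j \<in> set T"
    and "x \<noteq> y" "x \<notin> crossings D" "y \<notin> crossings D"
    and E: "code E = fill (pair_word par i j s x y) T"
  shows "wf_diagram E"
proof (rule wf_fill[OF assms(1,2) E])
  fix k u t assume "Inr k \<in> set T" and ut: "(u, t) \<in> set (pair_word par i j s x y k)"
  then have "(u, other t) \<in> set (pair_word par i j s x y i) \<union> set (pair_word par i j s x y j)"
    using assms(3) by (auto simp: pair_word_def split: if_splits)
  then show "\<exists>l. Inr l \<in> set T \<and> (u, other t) \<in> set (pair_word par i j s x y l)"
    using assms(4,5) by auto
qed (use assms in \<open>auto simp: pair_word_def split: if_splits\<close>)

lemma wf_triple:
  assumes "wf_diagram D" "template_of D T" "distinct [i, j, k]" "{Inr i, Inr j, Inr k} \<subseteq> set T"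
    and "distinct [a, a', b, b', c, c']" "{a, a', b, b', c, c'} \<inter> crossings D = {}"
    and E: "code E = fill (triple_word i j k s a a' b b' c c') T"
  shows "wf_diagram E"
proof (rule wf_fill[OF assms(1,2) E])
  let ?w = "triple_word i j k s a a' b b' c c'"
  have d: "distinct (?w i @ ?w j @ ?w k)"
    using assms(3,5) by (simp add: triple_word_def) metis
  have nil: "l \<notin> {i, j, k} \<Longrightarrow> ?w l = []" for l
    by (simp add: triple_word_def)
  show "distinct (?w l)" for l
    using d nil[of l] by (cases "l \<in> {i, j, k}") auto
  show "set (?w l) \<inter> set (?w m) = {}" if "l \<noteq> m" for l m
    using d nil[of l] nil[of m] that
    by (cases "l \<in> {i, j, k}"; cases "m \<in> {i, j, k}") auto
  have U: "(u, t) \<in> set (?w i) \<union> set (?w j) \<union> set (?w k) \<longleftrightarrow> u \<in> {a, a', b, b', c, c'}" for u t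
    using assms(3) by (cases "t = s") (simp_all add: triple_word_def neq_strand_iff, blast+)
  have in_U: "u \<in> {a, a', b, b', c, c'}" if "(u, t) \<in> set (?w l)" for l u t
  proof -
    have "l \<in> {i, j, k}" using that nil[of l] by (metis empty_iff empty_set)
    then have "(u, t) \<in> set (?w i) \<union> set (?w j) \<union> set (?w k)" using that by blast
    then show ?thesis unfolding U .
  qed
  show "u \<notin> crossings D" if "(u, t) \<in> set (?w l)" for l u t
    using in_U[OF that] assms(6) by blast
  show "\<exists>m. Inr m \<in> set T \<and> (u, other t) \<in> set (?w m)" if "(u, t) \<in> set (?w l)" for l u t
    using in_U[OF that] assms(4) U[of u "other t"] by blast
qed

lemma pair_bigon:
  assumes "i \<noteq> j" "Inr i \<in> set T" "Inr j \<in> set T" "code E = fill (pair_word par i j s x y) T"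
  shows "bigon E x y"
proof -
  have "follows E (x, s) (y, other s)"
    by (rule follows_fill[OF assms(2) _ assms(4), where u = "[]" and w = "[]"]) (simp add: pair_word_def assms(1))
  moreover have "if par then follows E (x, other s) (y, s) else follows E (y, s) (x, other s)"
    by (auto intro!: follows_fill[OF assms(3) _ assms(4), where u = "[]" and w = "[]"] simp: pair_word_def)
  ultimately show ?thesis unfolding bigon_def by (auto split: if_splits)
qed

text \<open>
  The sides run from \<open>a'\<close> to \<open>b\<close>, from \<open>a'\<close> to \<open>c\<close> and from \<open>c\<close> to \<open>b\<close>; their order around the triangle
  depends on which way the picture is mirrored, i.e. on \<open>s\<close>. The last hypothesis excludes the
  heights that are cyclic among the three segments.
\<close>

lemma triple_triangle:
  assumes "wf_diagram D" "template_of D T" "distinct [i, j, k]" "{Inr i, Inr j, Inr k} \<subseteq> set T"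
    and "distinct [a, a', b, b', c, c']" "{a, a', b, b', c, c'} \<inter> crossings D = {}"
    and E: "code E = fill (triple_word i j k s a a' b b' c c') T"
    and ov: "over E a' = other (over E a)" "\<not> (over E a = over E c \<and> over E c \<noteq> over E b)"
  shows "\<exists>E'. if s = SWNE then R3 E (a', NW) (c, SW) (b, SE) E' else R3 E (a', NW) (b, SE) (c, NE) E'"
proof -
  have f: "follows E (a', other s) (b, s)"
     "follows E (a', s) (c, s)"
     "follows E (c, other s) (b, other s)"
    by (rule follows_fill[OF _ _ E, where k = i and u = "[(a, s)]" and w = "[(b', other s)]"]
      follows_fill[OF _ _ E, where k = j and u = "[(a, other s)]" and w = "[(c', other s)]"]
      follows_fill[OF _ _ E, where k = k and u = "[(c', s)]" and w = "[(b', s)]"];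
      use assms(3,4) in \<open>simp add: triple_word_def\<close>)+
  have wf: "wf_diagram E" by (rule wf_triple[OF assms(1-7)])
  note simps = side_def joined_def incoming_def side_start_def is_over_def
  show ?thesis
  proof (cases s)
    case SWNE
    have "side E (a', NW) (c, SW)" "side E (c, SW) (b, SE)" "side E (b, SE) (a', NW)"
      using f SWNE by (simp_all add: simps)
    moreover have "\<not> (is_over E (side_start (a', NW)) = is_over E (side_start (c, SW)) \<and>
        is_over E (side_start (c, SW)) = is_over E (side_start (b, SE)))"
      using ov by (cases "over E a"; cases "over E b"; cases "over E c") (simp_all add: simps)
    moreover have "distinct [fst (a', NW), fst (c, SW), fst (b, SE)]"
      using assms(5) by auto
    ultimately show ?thesis using R3_exists[OF wf] SWNE by metis
  next
    case SENW
    have "side E (a', NW) (b, SE)" "side E (b, SE) (c, NE)" "side E (c, NE) (a', NW)"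
      using f SENW by (simp_all add: simps)
    moreover have "\<not> (is_over E (side_start (a', NW)) = is_over E (side_start (b, SE)) \<and>
        is_over E (side_start (b, SE)) = is_over E (side_start (c, NE)))"
      using ov by (cases "over E a"; cases "over E b"; cases "over E c") (simp_all add: simps)
    moreover have "distinct [fst (a', NW), fst (b, SE), fst (c, NE)]"
      using assms(5) by auto
    ultimately show ?thesis using R3_exists[OF wf] SENW by (metis strand.distinct(1))
  qed
qed


section \<open>Values of a parity on inserted pairs\<close>

locale parity =
  fixes K :: "diagram set" and p :: "diagram \<Rightarrow> nat \<Rightarrow> 'a::ab_group_add"
  assumes knot: "virtual_knot K" and parity: "oriented_parity K p"
begin

lemma move_wf: "move D D' f S \<Longrightarrow> wf_diagram D'"
proof (induction rule: move.induct)
qed (simp_all only: diagram_iso_def R1_dec_def R2_dec_def R3_def)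

lemma knot_wf:
  assumes "D \<in> K"
  shows "wf_diagram D"
proof -
  obtain D0 where D0: "wf_diagram D0" and K: "K = {D'. (\<lambda>E E'. \<exists>f S. move E E' f S)\<^sup>*\<^sup>* D0 D'}"
    using knot by (auto simp: virtual_knot_def)
  have "(\<lambda>E E'. \<exists>f S. move E E' f S)\<^sup>*\<^sup>* D0 D"
    using assms unfolding K by simp
  then show ?thesis
  proof (induction rule: rtranclp_induct)
    case base
    then show ?case by (rule D0)
  next
    case (step y z)
    then show ?case using move_wf by blast
  qed
qed

lemma knot_move:
  assumes "D \<in> K" "move D D' f S"
  shows "D' \<in> K"
proof -
  obtain D0 where K: "K = {D'. (\<lambda>E E'. \<exists>f S. move E E' f S)\<^sup>*\<^sup>* D0 D'}"
    using knot by (auto simp: virtual_knot_def)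
  have "(\<lambda>E E'. \<exists>f S. move E E' f S)\<^sup>*\<^sup>* D0 D"
    using assms(1) unfolding K by simp
  moreover have "\<exists>f S. move D D' f S" using assms(2) by blast
  ultimately show ?thesis unfolding K by (simp add: rtranclp.rtrancl_into_rtrancl)
qed

lemma p_move: "D \<in> K \<Longrightarrow> move D D' f S \<Longrightarrow> v \<in> crossings D \<Longrightarrow> f v = Some w \<Longrightarrow> p D v = p D' w"
  using parity[unfolded oriented_parity_def, THEN conjunct1] by blast

lemma p_R2: "D \<in> K \<Longrightarrow> R2_dec D v w D' \<Longrightarrow> p D v + p D w = 0"
  using parity[unfolded oriented_parity_def, THEN conjunct2, THEN conjunct2, THEN conjunct1] by blast

lemma p_R3: "D \<in> K \<Longrightarrow> R3 D x y z D' \<Longrightarrow>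
    eps x (p D (fst x)) + eps y (p D (fst y)) + eps z (p D (fst z)) = 0"
  using parity[unfolded oriented_parity_def, THEN conjunct2, THEN conjunct2, THEN conjunct2] by blast

lemma iso_knot: "D \<in> K \<Longrightarrow> diagram_iso g D D' \<Longrightarrow> D' \<in> K"
  using knot_move move.iso by blast

lemma p_iso: "D \<in> K \<Longrightarrow> diagram_iso g D D' \<Longrightarrow> v \<in> crossings D \<Longrightarrow> p D v = p D' (g v)"
  using p_move[OF _ move.iso, of D g D' v "g v"] by simp

lemma R2_knot_up: "D' \<in> K \<Longrightarrow> R2_dec D v w D' \<Longrightarrow> D \<in> K"
  using knot_move move.R2_increasing by blast

lemma R2_knot_down: "D \<in> K \<Longrightarrow> R2_dec D v w D' \<Longrightarrow> D' \<in> K"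
  using knot_move move.R2_decreasing by blast

lemma deletes_crossings: "deletes D S D' \<Longrightarrow> crossings D' = crossings D - S"
  by (auto simp: deletes_def crossings_def)

lemma p_R2_other:
  assumes "D' \<in> K" "R2_dec D v w D'" "u \<in> crossings D'"
  shows "p D u = p D' u"
  using p_move[OF assms(1) move.R2_increasing[OF assms(2)] assms(3)] assms(3) by simp

text \<open>
  The height function of \<open>E\<close> may be any extension of the one of \<open>D\<close>, so that all diagrams which arise
  from one diagram by removing pairs can share the same height function.
\<close>

lemma pair_R2:
  assumes "wf_diagram D" "template_of D T" "i \<noteq> j" "{Inr i, Inr j} \<subseteq> set T"
    and "x \<noteq> y" "{x, y} \<inter> crossings D = {}"
    and "code E = fill (pair_word par i j s x y) T"
    and "\<And>u. u \<in> crossings D \<Longrightarrow> over E u = over D u" "over E y = other (over E x)"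
  shows "R2_dec E x y D"
proof (rule R2_decI)
  show "wf_diagram E" using wf_pair[OF assms(1-3) _ _ assms(5) _ _ assms(7)] assms(4,6) by auto
  show "bigon E x y" using pair_bigon[OF assms(3) _ _ assms(7)] assms(4) by auto
  have "(\<lambda>k. filter (\<lambda>z. fst z \<notin> {x, y}) (pair_word par i j s x y k)) = (\<lambda>_. [])"
    by (simp add: pair_word_def fun_eq_iff)
  moreover have "fst z \<notin> {x, y}" if "Inl z \<in> set T" for z
    using that assms(6) template_base[OF assms(2)] by (auto simp: crossings_def)
  ultimately have "filter (\<lambda>z. fst z \<notin> {x, y}) (fill (pair_word par i j s x y) T) = fill (\<lambda>_. []) T"
    using filter_fill[of T "\<lambda>z. fst z \<notin> {x, y}" "pair_word par i j s x y"] by metis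
  then show "code D = filter (\<lambda>z. fst z \<notin> {x, y}) (code E)"
    using assms(2) unfolding assms(7) template_of_def by simp
  show "x \<noteq> y" "over E y = other (over E x)" by (rule assms)+
  show "over D u = over E u" if "u \<in> crossings D" for u
    using assms(8)[OF that] by simp
qed

text \<open>
  The value at the first crossing \<open>x\<close> of an inserted pair with \<open>over x = h\<close>, for one particular
  choice of names. Below, \<open>R(i, j)\<close> stands for this value with \<open>par\<close> true and \<open>Q(i, j)\<close> with \<open>par\<close> false.
\<close>

definition pair_value :: "diagram \<Rightarrow> template \<Rightarrow> bool \<Rightarrow> nat \<Rightarrow> nat \<Rightarrow> strand \<Rightarrow> strand \<Rightarrow> 'a" where
  "pair_value D T par i j s h = (let x = fresh D; y = Suc x in
     p (dia (fill (pair_word par i j s x y) T) ((over D)(x := h, y := other h))) x)"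

text \<open>
  Two choices of names for the new crossings differ by an isomorphism of diagrams, under which the
  parity is invariant.
\<close>

lemma pair_value_eq:
  assumes "D \<in> K" "template_of D T" "i \<noteq> j" "{Inr i, Inr j} \<subseteq> set T"
    and "x \<noteq> y" "{x, y} \<inter> crossings D = {}"
    and "code E = fill (pair_word par i j s x y) T"
    and "\<And>u. u \<in> crossings D \<Longrightarrow> over E u = over D u" "over E y = other (over E x)"
  shows "p E x = pair_value D T par i j s (over E x)"
proof -
  note wf = knot_wf[OF assms(1)]
  define x' where "x' = fresh D"
  define E' where "E' = dia (fill (pair_word par i j s x' (Suc x')) T)
    ((over D)(x' := over E x, Suc x' := other (over E x)))"
  have x': "x' \<notin> crossings D" "Suc x' \<notin> crossings D"
    using Suc_fresh_notin by (simp_all add: x'_def)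
  have R2: "R2_dec E x y D" by (rule pair_R2[OF wf assms(2-9)])
  then have EK: "E \<in> K" using R2_knot_up assms(1) by blast
  have R2': "R2_dec E' x' (Suc x') D"
    by (rule pair_R2[OF wf assms(2-4), where par = par and s = s]) (use x' in \<open>auto simp: E'_def\<close>)
  have cE: "crossings E = insert x (insert y (crossings D))"
  proof -
    have "bigon E x y" using pair_bigon[OF assms(3) _ _ assms(7)] assms(4) by auto
    then have "x \<in> crossings E" "y \<in> crossings E"
      using code_crossings follows_set unfolding bigon_def by metis+
    then show ?thesis using R2 deletes_crossings by (auto simp: R2_dec_def)
  qed
  define g where "g = (\<lambda>u. if u = x then x' else if u = y then Suc x' else u)"
  have "diagram_iso g E E'"
    unfolding diagram_iso_def
  proof (intro conjI)
    show "inj_on g (crossings E)"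
      using x' assms(6) unfolding cE inj_on_def g_def by auto
    have "map (map_prod g id) (fill (pair_word par i j s x y) T) =
        fill (pair_word par i j s x' (Suc x')) T"
    proof (subst map_fill)
      show "map_prod g id z = z" if "Inl z \<in> set T" for z
        using that assms(6) template_base[OF assms(2), of z]
        by (cases z) (auto simp: g_def dest: code_crossings)
      have "(\<lambda>k. map (map_prod g id) (pair_word par i j s x y k)) = pair_word par i j s x' (Suc x')"
        using assms(5) by (auto simp: pair_word_def g_def fun_eq_iff)
      then show "fill (\<lambda>k. map (map_prod g id) (pair_word par i j s x y k)) T =
        fill (pair_word par i j s x' (Suc x')) T" by simp
    qed
    then show "\<exists>k. code E' = rotate k (map (map_prod g id) (code E))"
      by (intro exI[of _ 0]) (simp add: assms(7) E'_def)
    show "\<forall>v \<in> crossings E. over E' (g v) = over E v"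
    proof
      fix v assume "v \<in> crossings E"
      then consider "v = x" | "v = y" | "v \<in> crossings D" "v \<noteq> x" "v \<noteq> y"
        unfolding cE using assms(6) by blast
      then show "over E' (g v) = over E v"
      proof cases
        case 3
        then have "v \<noteq> x'" "v \<noteq> Suc x'" using x' by auto
        then show ?thesis using 3 assms(8) by (simp add: g_def E'_def)
      qed (use assms(5,9) in \<open>simp_all add: g_def E'_def\<close>)
    qed
    show "wf_diagram E" "wf_diagram E'"
      using R2 R2' by (simp_all add: R2_dec_def)
  qed
  then have "p E x = p E' (g x)" by (rule p_iso[OF EK]) (simp add: cE)
  then show ?thesis by (simp add: g_def pair_value_def E'_def x'_def Let_def)
qed

end


lemma fill_bigon:
  assumes "{Inr i, Inr j} \<subseteq> set T" "code E = fill \<sigma> T"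
    and "\<sigma> i = u @ (x, s) # (y, other s) # w"
    and "\<sigma> j = u' @ (x, other s) # (y, s) # w' \<or> \<sigma> j = u' @ (y, s) # (x, other s) # w'"
  shows "bigon E x y"
proof -
  have "follows E (x, s) (y, other s)"
    using follows_fill[OF _ assms(3,2)] assms(1) by blast
  moreover have "follows E (x, other s) (y, s) \<or> follows E (y, s) (x, other s)"
    using assms(4) follows_fill[of j T \<sigma> u' _ _ w' E] assms(1,2) by blast
  ultimately show ?thesis unfolding bigon_def by blast
qed

lemma fill_R2:
  assumes "wf_diagram E" "template_of D T" "code E = fill \<sigma> T" "bigon E x y" "x \<noteq> y"
    and "over E y = other (over E x)" "{x, y} \<inter> crossings D = {}"
    and "\<And>k. filter (\<lambda>z. fst z \<notin> {x, y}) (\<sigma> k) = \<tau> k"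
  shows "R2_dec E x y (dia (fill \<tau> T) (over E))"
proof (rule R2_decI)
  have "fst z \<notin> {x, y}" if "Inl z \<in> set T" for z
    using that assms(7) template_base[OF assms(2)] by (auto simp: crossings_def)
  then have "filter (\<lambda>z. fst z \<notin> {x, y}) (code E) = fill (\<lambda>k. filter (\<lambda>z. fst z \<notin> {x, y}) (\<sigma> k)) T"
    unfolding assms(3) by (rule filter_fill)
  then have "filter (\<lambda>z. fst z \<notin> {x, y}) (code E) = fill \<tau> T"
    unfolding assms(8) .
  then show "code (dia (fill \<tau> T) (over E)) = filter (\<lambda>z. fst z \<notin> {x, y}) (code E)"
    by simp
qed (use assms(1,4-6) in simp_all)

section \<open>The triangle relation\<close>

context parity
begin

text \<open>
  Let all three pairs cross at the same time. Each pair keeps the value it has when it is alone,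
  because the other two can be removed by second moves. At the triangle \<open>a'\<close>, \<open>c\<close>, \<open>b\<close> the axiom for third moves reads \<open>p c = p a' + p b\<close>, and \<open>p a' = - p a\<close>.
\<close>

lemma triangle_relation:
  assumes D: "D \<in> K" "template_of D T" and ijk: "distinct [i, j, k]" "{Inr i, Inr j, Inr k} \<subseteq> set T"
    and h: "\<not> (h12 = h23 \<and> h23 \<noteq> h13)"
  shows "pair_value D T True i k s h13 - pair_value D T True i j s h12 = pair_value D T False j k s h23"
proof -
  obtain a a' b b' c c' where new: "distinct [a, a', b, b', c, c']"
    "{a, a', b, b', c, c'} \<inter> crossings D = {}"
  proof
    let ?n = "fresh D"
    note f = fresh_notin[of D]
    show "distinct [?n, ?n + 1, ?n + 2, ?n + 3, ?n + 4, ?n + 5]" by simp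
    show "{?n, ?n + 1, ?n + 2, ?n + 3, ?n + 4, ?n + 5} \<inter> crossings D = {}"
      using f[of 0] f[of 1] f[of 2] f[of 3] f[of 4] f[of 5] by simp
  qed
  define ov where "ov = (over D)(a := h12, a' := other h12, b := h13, b' := other h13,
    c := h23, c' := other h23)"
  have ov: "ov a = h12" "ov a' = other h12" "ov b = h13" "ov b' = other h13" "ov c = h23" "ov c' = other h23"
    using new(1) by (simp_all add: ov_def)
  have ovD: "ov u = over D u" if "u \<in> crossings D" for u
    using new(2) that by (auto simp: ov_def)
  define E where "E = dia (fill (triple_word i j k s a a' b b' c c') T) ov"
  define w1 where "w1 = (\<lambda>_. [])(i := [(a, s), (a', other s), (b, s), (b', other s)],
     j := [(a, other s), (a', s)], k := [(b, other s), (b', s)])"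
  define w2 where "w2 = (\<lambda>_. [])(i := [(a, s), (a', other s)],
     j := [(a, other s), (a', s), (c, s), (c', other s)], k := [(c', s), (c, other s)])"
  let ?F = "\<lambda>w. dia (fill w T) ov"
  have wfD: "wf_diagram D" by (rule knot_wf[OF D(1)])
  have wfE: "wf_diagram E"
    by (rule wf_triple[OF wfD D(2) ijk new]) (simp add: E_def)
  have neq: "a \<notin> {a', b, b', c, c'}" "a' \<notin> {a, b, b', c, c'}" "b \<notin> {a, a', b', c, c'}"
    "b' \<notin> {a, a', b, c, c'}" "c \<notin> {a, a', b, b', c'}" "c' \<notin> {a, a', b, b', c}"
    "k \<notin> {i, j}" "j \<notin> {i, k}" "i \<notin> {j, k}"
    using new(1) ijk(1) by auto
  note upd = triple_word_def w1_def w2_def pair_word_def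
  have E_c: "R2_dec E c c' (?F w1)"
  proof -
    have "bigon E c c'"
      by (rule fill_bigon[of j k T E "triple_word i j k s a a' b b' c c'" "[(a, other s), (a', s)]" _ s _ "[]"
            "[]" "[(b, other s), (b', s)]"])
        (use ijk in \<open>simp_all add: E_def upd\<close>)
    moreover have "filter (\<lambda>z. fst z \<notin> {c, c'}) (triple_word i j k s a a' b b' c c' l) = w1 l" for l
      by (simp add: upd neq[simplified])
    ultimately show ?thesis
      using fill_R2[OF wfE D(2), of "triple_word i j k s a a' b b' c c'" c c' w1] new ov
      by (simp add: E_def)
  qed
  have E_b: "R2_dec E b b' (?F w2)"
  proof -
    have "bigon E b b'"
      by (rule fill_bigon[of i k T E "triple_word i j k s a a' b b' c c'" "[(a, s), (a', other s)]" _ s _ "[]"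
            "[(c', s), (c, other s)]" "[]"])
        (use ijk in \<open>simp_all add: E_def upd\<close>)
    moreover have "filter (\<lambda>z. fst z \<notin> {b, b'}) (triple_word i j k s a a' b b' c c' l) = w2 l" for l
      by (simp add: upd neq[simplified])
    ultimately show ?thesis
      using fill_R2[OF wfE D(2), of "triple_word i j k s a a' b b' c c'" b b' w2] new ov
      by (simp add: E_def)
  qed
  have E_a: "\<exists>E'. R2_dec E a a' E'"
  proof -
    have "bigon E a a'"
      by (rule fill_bigon[of i j T E "triple_word i j k s a a' b b' c c'" "[]" _ s _ "[(b, s), (b', other s)]"
            "[]" "[(c, s), (c', other s)]"])
        (use ijk in \<open>simp_all add: E_def upd\<close>)
    then have "R2_dec E a a' (dia (fill (\<lambda>l. filter (\<lambda>z. fst z \<notin> {a, a'}) (triple_word i j k s a a' b b' c c' l)) T) (over E))"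
      by (intro fill_R2[OF wfE D(2)]) (use new ov in \<open>auto simp: E_def\<close>)
    then show ?thesis by blast
  qed
  have wf1: "wf_diagram (?F w1)" and wf2: "wf_diagram (?F w2)"
    using E_c E_b by (simp_all add: R2_dec_def)
  have w1_b: "R2_dec (?F w1) b b' (?F (pair_word True i j s a a'))"
  proof -
    have "bigon (?F w1) b b'"
      by (rule fill_bigon[of i k T _ w1 "[(a, s), (a', other s)]" _ s _ "[]" "[]" "[]"])
        (use ijk in \<open>simp_all add: upd\<close>)
    moreover have "filter (\<lambda>z. fst z \<notin> {b, b'}) (w1 l) = pair_word True i j s a a' l" for l
      by (simp add: upd neq[simplified])
    ultimately show ?thesis
      using fill_R2[OF wf1 D(2), of w1 b b'] new ov by simp
  qed
  have w1_a: "R2_dec (?F w1) a a' (?F (pair_word True i k s b b'))"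
  proof -
    have "bigon (?F w1) a a'"
      by (rule fill_bigon[of i j T _ w1 "[]" _ s _ "[(b, s), (b', other s)]" "[]" "[]"])
        (use ijk in \<open>simp_all add: upd\<close>)
    moreover have "filter (\<lambda>z. fst z \<notin> {a, a'}) (w1 l) = pair_word True i k s b b' l" for l
      by (simp add: upd neq[simplified])
    ultimately show ?thesis
      using fill_R2[OF wf1 D(2), of w1 a a'] new ov by simp
  qed
  have w2_a: "R2_dec (?F w2) a a' (?F (pair_word False j k s c c'))"
  proof -
    have "bigon (?F w2) a a'"
      by (rule fill_bigon[of i j T _ w2 "[]" _ s _ "[]" "[]" "[(c, s), (c', other s)]"])
        (use ijk in \<open>simp_all add: upd\<close>)
    moreover have "filter (\<lambda>z. fst z \<notin> {a, a'}) (w2 l) = pair_word False j k s c c' l" for l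
      by (simp add: upd neq[simplified])
    ultimately show ?thesis
      using fill_R2[OF wf2 D(2), of w2 a a'] new ov by simp
  qed
  have D_a: "R2_dec (?F (pair_word True i j s a a')) a a' D"
    by (rule pair_R2[OF wfD D(2)]) (use new ijk ov ovD in auto)
  \<comment> \<open>Adding the pairs one by one leads from \<open>D\<close> to \<open>E\<close>; removing other pairs isolates the second and the third one.\<close>
  note EK12 = R2_knot_up[OF D(1) D_a]
  note EK1 = R2_knot_up[OF EK12 w1_b]
  note EK = R2_knot_up[OF EK1 E_c]
  note EK13 = R2_knot_down[OF EK1 w1_a]
  note EK2 = R2_knot_down[OF EK E_b]
  note EK23 = R2_knot_down[OF EK2 w2_a]
  have mem: "u \<in> crossings (?F w)" if "(u, t) \<in> set (w l)" "Inr l \<in> set T" for u t w l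
    using that by (force simp: crossings_def set_fill)
  have "p E a = pair_value D T True i j s h12"
  proof -
    have "p E a = p (?F w1) a"
      by (rule p_R2_other[OF EK1 E_c]) (rule mem[of _ s _ i], use ijk in \<open>auto simp: upd\<close>)
    also have "\<dots> = p (?F (pair_word True i j s a a')) a"
      by (rule p_R2_other[OF EK12 w1_b]) (rule mem[of _ s _ i], use ijk in \<open>auto simp: upd\<close>)
    also have "\<dots> = pair_value D T True i j s (ov a)"
      using pair_value_eq[OF D, of i j a a' "?F (pair_word True i j s a a')" True s] new ijk ov ovD by simp
    finally show ?thesis by (simp add: ov)
  qed
  moreover have "p E b = pair_value D T True i k s h13"
  proof -
    have "p E b = p (?F w1) b"
      by (rule p_R2_other[OF EK1 E_c]) (rule mem[of _ s _ i], use ijk in \<open>auto simp: upd\<close>)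
    also have "\<dots> = p (?F (pair_word True i k s b b')) b"
      by (rule p_R2_other[OF EK13 w1_a]) (rule mem[of _ s _ i], use ijk in \<open>auto simp: upd\<close>)
    also have "\<dots> = pair_value D T True i k s (ov b)"
      using pair_value_eq[OF D, of i k b b' "?F (pair_word True i k s b b')" True s] new ijk ov ovD by simp
    finally show ?thesis by (simp add: ov)
  qed
  moreover have "p E c = pair_value D T False j k s h23"
  proof -
    have "p E c = p (?F w2) c"
      by (rule p_R2_other[OF EK2 E_b]) (rule mem[of _ s _ j], use ijk in \<open>auto simp: upd\<close>)
    also have "\<dots> = p (?F (pair_word False j k s c c')) c"
      by (rule p_R2_other[OF EK23 w2_a]) (rule mem[of _ s _ j], use ijk in \<open>auto simp: upd\<close>)
    also have "\<dots> = pair_value D T False j k s (ov c)"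
      using pair_value_eq[OF D, of j k c c' "?F (pair_word False j k s c c')" False s] new ijk ov ovD by simp
    finally show ?thesis by (simp add: ov)
  qed
  moreover have "p E a' = - p E a"
    using p_R2[OF EK] E_a by (metis minus_unique)
  moreover have "p E c = p E a' + p E b"
  proof -
    have "\<exists>E'. if s = SWNE then R3 E (a', NW) (c, SW) (b, SE) E' else R3 E (a', NW) (b, SE) (c, NE) E'"
      by (rule triple_triangle[OF wfD D(2) ijk new]) (use ov h in \<open>simp_all add: E_def\<close>)
    then have "if s = SWNE then - p E a' + p E c - p E b = 0 else - p E a' - p E b + p E c = 0"
      using p_R3[OF EK, of "(a', NW)" "(c, SW)" "(b, SE)"] p_R3[OF EK, of "(a', NW)" "(b, SE)" "(c, NE)"]
      by (auto simp: eps_def)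
    then show ?thesis by (auto simp: algebra_simps split: if_splits)
  qed
  ultimately show ?thesis by simp
qed

text \<open>
  A third segment over or under both others leaves the heights of those two free, so \<open>Q\<close> does not
  depend on the height. In the relation for \<open>R(i, k) - R(i, j)\<close> the height of the pair \<open>i\<close>, \<open>k\<close> can then
  be changed as well, with the height of \<open>j\<close>, \<open>k\<close> adjusted to stay admissible.
\<close>

lemma height_irrelevant:
  assumes D: "D \<in> K" "template_of D T" and ijk: "distinct [i, j, k]" "{Inr i, Inr j, Inr k} \<subseteq> set T"
  shows "pair_value D T par i k s h = pair_value D T par i k s h'"
proof -
  have Q: "pair_value D T False j k s h = pair_value D T False j k s h'"
    if "distinct [i, j, k]" "{Inr i, Inr j, Inr k} \<subseteq> set T" for i j k h h'
    using triangle_relation[OF D that, of SWNE h SWNE s] triangle_relation[OF D that, of SWNE h' SWNE s]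
    by simp
  show ?thesis
  proof (cases par)
    case True
    then show ?thesis
      using triangle_relation[OF D ijk, of h' h h s] triangle_relation[OF D ijk, of h' h' h' s]
        Q[OF ijk, of h h'] by (metis diff_add_cancel)
  next
    case False
    then show ?thesis using Q[of j i k h h'] ijk by auto
  qed
qed

end


section \<open>The parity cycle\<close>

text \<open>
  Addressing the legs at a crossing by passages: the arcs before and after a passage are incoming and
  outgoing legs, and consecutive passages share an arc.
\<close>

definition before_arc :: "diagram \<Rightarrow> passage \<Rightarrow> nat" where
  "before_arc D x = leg_arc D (fst x) (if snd x = SWNE then SW else SE)"

definition after_arc :: "diagram \<Rightarrow> passage \<Rightarrow> nat" where
  "after_arc D x = leg_arc D (fst x) (if snd x = SWNE then NE else NW)"

lemma pos_eq:
  assumes "distinct (code D)" "code D = A @ x # B"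
  shows "pos D x = length A"
  unfolding pos_def
proof (rule the_equality)
  show "length A < length (code D) \<and> code D ! length A = x" using assms(2) by simp
  fix i assume "i < length (code D) \<and> code D ! i = x"
  then show "i = length A"
    using assms nth_eq_iff_index_eq[of "code D" i "length A"] by simp
qed

lemma before_arc_eq:
  assumes "distinct (code D)" "code D = A @ x # B"
  shows "before_arc D x = (if A = [] then length B else length A - 1)"
proof -
  have "before_arc D x = (pos D x + length (code D) - 1) mod length (code D)"
    by (cases x; cases "snd x") (simp_all add: before_arc_def leg_arc_def incoming_def)
  also have "pos D x = length A" by (rule pos_eq[OF assms])
  also have "(length A + length (code D) - 1) mod length (code D) = (if A = [] then length B else length A - 1)"
  proof (cases A)
    case (Cons a A')
    then have "length A + length (code D) - 1 = length A' + length (code D)" by simp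
    then show ?thesis using Cons assms(2) by (simp only: mod_add_self2) simp
  qed (simp add: assms(2))
  finally show ?thesis .
qed

lemma after_arc_eq:
  assumes "distinct (code D)" "code D = A @ x # B"
  shows "after_arc D x = length A"
proof -
  have "after_arc D x = pos D x"
    by (cases x; cases "snd x") (simp_all add: after_arc_def leg_arc_def incoming_def)
  then show ?thesis using pos_eq[OF assms] by simp
qed

lemma leg_arc_before_after:
  "leg_arc D v SW = before_arc D (v, SWNE)" "leg_arc D v SE = before_arc D (v, SENW)"
  "leg_arc D v NE = after_arc D (v, SWNE)" "leg_arc D v NW = after_arc D (v, SENW)"
  by (simp_all add: before_arc_def after_arc_def)

lemma follows_arc:
  assumes "wf_diagram D" "follows D x y"
  shows "after_arc D x = before_arc D y"
proof -
  have d: "distinct (code D)" using assms(1) by (simp add: wf_diagram_iff)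
  show ?thesis
    using assms(2) unfolding follows_iff
  proof (elim disjE exE conjE)
    fix u w assume c: "code D = u @ x # y # w"
    then have "code D = (u @ [x]) @ y # w" by simp
    from before_arc_eq[OF d this] after_arc_eq[OF d c] show ?thesis by simp
  next
    assume n: "code D \<noteq> []" and l: "last (code D) = x" and h: "hd (code D) = y"
    have "code D = butlast (code D) @ x # []" using n l append_butlast_last_id by metis
    moreover have "code D = [] @ y # tl (code D)" using n h by (cases "code D") simp_all
    ultimately show ?thesis
      using before_arc_eq[OF d, of "[]" y "tl (code D)"] after_arc_eq[OF d, of "butlast (code D)" x "[]"]
      by simp
  qed
qed

lemma template_slots:
  assumes "wf_diagram D" "code D = A @ B" "distinct ks"
  shows "template_of D (map Inl A @ map Inr ks @ map Inl B)"
proof -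
  have "fill (\<lambda>_. []) (map Inr ks) = []" by (induction ks) auto
  moreover have "distinct (A @ B)" using assms(1,2) by (simp add: wf_diagram_iff)
  ultimately show ?thesis
    using assms(2,3) by (auto simp: template_of_def distinct_map inj_on_def)
qed

text \<open>
  The hypothesis says that the two readings have their gap at the same place of the closed curve;
  then inserting the same word there gives the same cyclic code.
\<close>

lemma rotate_insert:
  assumes "B' @ A' = B @ A"
  shows "\<exists>k. A' @ W @ B' = rotate k (A @ W @ B)"
proof -
  have "rotate (length A) (A @ W @ B) = (W @ B') @ A'"
    using rotate_append[of A "W @ B"] assms by simp
  then have "rotate (length (W @ B')) (rotate (length A) (A @ W @ B)) = A' @ W @ B'"
    using rotate_append[of "W @ B'" A'] by simp
  then show ?thesis unfolding rotate_rotate by metis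
qed

context parity
begin

lemma pair_value_cong:
  assumes "\<And>x y. fill (pair_word par i j s x y) T = fill (pair_word par i' j' s x y) T'"
  shows "pair_value D T par i j s h = pair_value D T' par i' j' s h"
  by (simp add: pair_value_def assms)

lemma pair_value_swap:
  "i \<noteq> j \<Longrightarrow> pair_value D T True j i (other s) h = pair_value D T True i j s h"
  by (simp add: pair_value_def pair_word_def fun_upd_twist)

text \<open>
  The coefficient of the parity cycle at the point between \<open>A\<close> and \<open>B\<close>, with one choice of sides and
  heights.
\<close>

definition arc_value :: "diagram \<Rightarrow> passage list \<Rightarrow> passage list \<Rightarrow> 'a" where
  "arc_value D A B = pair_value D (map Inl A @ map Inr [0, 1] @ map Inl B) True 0 1 SWNE SWNE"

text \<open>
  Independence of sides and heights. Take three segments 0, 1, 2 of one arc. A pair inserted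
  on two of them gives the same code whichever two are taken. Hence
  \<open>Q(1, 2) = R(0, 2) - R(0, 1) = 0\<close>, and \<open>Q(0, 2)\<close> is the same value. So
  \<open>R(1, 2) - R(1, 0) = Q(0, 2) = 0\<close>. The segment 1 is the earlier one of the pair 1, 2 and the later one of
  the pair 1, 0, but lies on the same side in both; so the sides are exchanged relative to the order on
  the arc. The two heights are arbitrary.
\<close>

lemma arc_value_pair_value:
  assumes D: "D \<in> K" and c: "code D = A @ B"
  shows "pair_value D (map Inl A @ map Inr [0, 1] @ map Inl B) True 0 1 s h = arc_value D A B"
proof -
  let ?T2 = "map Inl A @ map Inr [0, 1] @ map Inl B"
  let ?T3 = "map Inl A @ map Inr [0, 1, 2] @ map Inl B"
  let ?R = "\<lambda>s h. pair_value D ?T2 True 0 1 s h"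
  have T: "template_of D ?T3"
    by (rule template_slots[OF knot_wf[OF D] c]) simp
  note rel = triangle_relation[OF D T]
  have R: "pair_value D ?T3 True 0 1 s h = ?R s h" "pair_value D ?T3 True 0 2 s h = ?R s h"
    "pair_value D ?T3 True 1 2 s h = ?R s h" for s h
    by (rule pair_value_cong, simp add: pair_word_def)+
  have Q0: "pair_value D ?T3 False 1 2 s h = 0" for s h
    using rel[of 0 1 2 h h h s] unfolding R by simp
  have Q: "pair_value D ?T3 False 0 2 s h = 0" for s h
  proof -
    have "pair_value D ?T3 False 0 2 s h = pair_value D ?T3 False 1 2 s h"
      by (rule pair_value_cong) (simp add: pair_word_def)
    then show ?thesis using Q0 by simp
  qed
  \<comment> \<open>Giving the pairs 1, 2 and 0, 2 the same height \<open>h\<close> makes every height \<open>h'\<close> of the pair 1, 0 admissible.\<close>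
  have flip: "?R s h = ?R (other s) h'" for s h h'
  proof -
    have "?R s h - pair_value D ?T3 True 1 0 s h' = 0"
      using rel[of 1 0 2 h' h h s] unfolding R Q by simp
    moreover have "pair_value D ?T3 True 1 0 s h' = ?R (other s) h'"
      using pair_value_swap[of 0 1 D ?T3 "other s" h'] unfolding R by simp
    ultimately show ?thesis by simp
  qed
  have "?R s h = ?R SWNE SWNE"
  proof (cases s)
    case SWNE
    then show ?thesis using flip[of SWNE h SWNE] flip[of SWNE SWNE SWNE] by simp
  next
    case SENW
    then show ?thesis using flip[of SENW h SWNE] by simp
  qed
  then show ?thesis by (simp add: arc_value_def)
qed

lemma self_pair:
  assumes D: "D \<in> K" and c: "code D = A @ B"
    and xy: "x \<noteq> y" "{x, y} \<inter> crossings D = {}"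
    and E: "code E = A @ [(x, s), (y, other s), (x, other s), (y, s)] @ B"
    and ov: "\<And>u. u \<in> crossings D \<Longrightarrow> over E u = over D u" "over E y = other (over E x)"
  shows "R2_dec E x y D" and "p E x = arc_value D A B"
proof -
  let ?T = "map Inl A @ map Inr [0, 1] @ map Inl B"
  have T: "template_of D ?T"
    by (rule template_slots[OF knot_wf[OF D] c]) simp
  have E': "code E = fill (pair_word True 0 1 s x y) ?T"
    using E by (simp add: pair_word_def)
  show "R2_dec E x y D"
    by (rule pair_R2[OF knot_wf[OF D] T _ _ xy E' ov]) auto
  have "p E x = pair_value D ?T True 0 1 s (over E x)"
    by (rule pair_value_eq[OF D T _ _ xy E' ov]) auto
  then show "p E x = arc_value D A B"
    using arc_value_pair_value[OF D c] by simp
qed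

lemma parity_cycle_eq:
  assumes D: "D \<in> K" and "a \<in> arcs D"
  shows "parity_cycle p D a = arc_value D (take (Suc a) (code D)) (drop (Suc a) (code D))"
proof -
  let ?A = "take (Suc a) (code D)" and ?B = "drop (Suc a) (code D)"
  let ?x = "fresh D"
  have c: "code D = ?A @ ?B" by simp
  have "(THE z. \<exists>v D'. self_R2 D a v D' \<and> z = p D' v) = arc_value D ?A ?B"
  proof (rule the_equality)
    let ?E = "dia (?A @ [(?x, SWNE), (Suc ?x, other SWNE), (?x, other SWNE), (Suc ?x, SWNE)] @ ?B)
      ((over D)(?x := SWNE, Suc ?x := other SWNE))"
    have xy: "?x \<noteq> Suc ?x" "{?x, Suc ?x} \<inter> crossings D = {}"
      using Suc_fresh_notin[of D] by auto
    have ov: "over ?E u = over D u" if "u \<in> crossings D" for u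
      using that xy by auto
    have "R2_dec ?E ?x (Suc ?x) D" "p ?E ?x = arc_value D ?A ?B"
      using self_pair[OF D c xy _ ov, where s = SWNE] by simp_all
    then have "self_R2 D a ?x ?E \<and> arc_value D ?A ?B = p ?E ?x"
      unfolding self_R2_def by auto
    then show "\<exists>v D'. self_R2 D a v D' \<and> arc_value D ?A ?B = p D' v" by blast
  next
    \<comment> \<open>A second move deletes crossings of opposite signs, so the pair has the heights required here.\<close>
    fix z assume "\<exists>v D'. self_R2 D a v D' \<and> z = p D' v"
    then obtain v D' w s where z: "z = p D' v" and R2: "R2_dec D' v w D"
      and code: "code D' = ?A @ [(v, s), (w, other s), (v, other s), (w, s)] @ ?B"
      unfolding self_R2_def by auto
    have del: "deletes D' {v, w} D" and vw: "v \<noteq> w" and ov: "over D' w = other (over D' v)"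
      using R2 by (simp_all add: R2_dec_iff)
    have "{v, w} \<inter> crossings D = {}"
      using deletes_crossings[OF del] by auto
    moreover have "over D' u = over D u" if "u \<in> crossings D" for u
      using del that by (simp add: deletes_def)
    ultimately show "z = arc_value D ?A ?B"
      unfolding z using self_pair(2)[OF D c vw _ code _ ov] by blast
  qed
  then show ?thesis using assms(2) by (simp add: parity_cycle_def)
qed

text \<open>
  The isomorphism extends to the diagrams with an inserted pair by matching the new crossings.
\<close>

lemma arc_value_iso:
  assumes D: "D \<in> K" and g: "diagram_iso g D D'"
    and c: "code D = A @ B" and c': "code D' = A' @ B'"
    and rot: "B' @ A' = map (map_prod g id) (B @ A)"
  shows "arc_value D A B = arc_value D' A' B'"
proof -
  define x where "x = fresh D"
  define x' where "x' = fresh D'"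
  define h where "h = g(x := x', Suc x := Suc x')"
  define E where "E = dia (A @ [(x, SWNE), (Suc x, other SWNE), (x, other SWNE), (Suc x, SWNE)] @ B)
      ((over D)(x := SWNE, Suc x := other SWNE))"
  define E' where "E' = dia (A' @ [(x', SWNE), (Suc x', other SWNE), (x', other SWNE), (Suc x', SWNE)] @ B')
      ((over D')(x' := SWNE, Suc x' := other SWNE))"
  have D': "D' \<in> K" by (rule iso_knot[OF D g])
  have xy: "x \<noteq> Suc x" "{x, Suc x} \<inter> crossings D = {}"
    using Suc_fresh_notin[of D] by (auto simp: x_def)
  have xy': "x' \<noteq> Suc x'" "{x', Suc x'} \<inter> crossings D' = {}"
    using Suc_fresh_notin[of D'] by (auto simp: x'_def)
  have ov: "over E u = over D u" if "u \<in> crossings D" for u using that xy by (auto simp: E_def)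
  have ov': "over E' u = over D' u" if "u \<in> crossings D'" for u using that xy' by (auto simp: E'_def)
  have R2: "R2_dec E x (Suc x) D" and p: "p E x = arc_value D A B"
    using self_pair[OF D c xy _ ov, where s = SWNE] by (simp_all add: E_def)
  have R2': "R2_dec E' x' (Suc x') D'" and p': "p E' x' = arc_value D' A' B'"
    using self_pair[OF D' c' xy' _ ov', where s = SWNE] by (simp_all add: E'_def)
  have cE: "crossings E = insert x (insert (Suc x) (crossings D))"
    by (auto simp: crossings_def E_def c image_Un)
  have g_mem: "g u \<in> crossings D'" if "u \<in> crossings D" for u
  proof -
    obtain k where "code D' = rotate k (map (map_prod g id) (code D))" using g by (auto simp: diagram_iso_def)
    then show ?thesis using that by (force simp: crossings_def)
  qed
  have hD: "h u = g u" if "u \<in> crossings D" for u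
    using that xy by (auto simp: h_def)
  have "map_prod h id z = map_prod g id z" if "z \<in> set A \<union> set B" for z
    using that hD code_crossings[of "fst z" "snd z" D] by (cases z) (auto simp: c)
  then have mapA: "map (map_prod h id) A = map (map_prod g id) A" and
    mapB: "map (map_prod h id) B = map (map_prod g id) B"
    by simp_all
  have "diagram_iso h E E'"
    unfolding diagram_iso_def
  proof (intro conjI)
    show "wf_diagram E" "wf_diagram E'" using R2 R2' by (simp_all add: R2_dec_def)
    have "inj_on g (crossings D)" using g by (simp add: diagram_iso_def)
    then have "inj_on h (crossings D)" using hD by (simp add: inj_on_def)
    moreover have "h x = x'" "h (Suc x) = Suc x'" by (simp_all add: h_def)
    moreover have "h ` crossings D \<inter> {x', Suc x'} = {}"
      using hD g_mem xy'(2) by auto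
    ultimately show "inj_on h (crossings E)"
      unfolding cE by auto
    have "map (map_prod h id) (code E) = map (map_prod g id) A @
        [(x', SWNE), (Suc x', other SWNE), (x', other SWNE), (Suc x', SWNE)] @ map (map_prod g id) B"
      by (simp add: E_def mapA mapB) (simp add: h_def)
    then show "\<exists>k. code E' = rotate k (map (map_prod h id) (code E))"
      using rotate_insert[of B' A' "map (map_prod g id) B" "map (map_prod g id) A"
          "[(x', SWNE), (Suc x', other SWNE), (x', other SWNE), (Suc x', SWNE)]"] rot
      by (simp add: E'_def)
    show "\<forall>v\<in>crossings E. over E' (h v) = over E v"
    proof
      fix v assume "v \<in> crossings E"
      then consider "v = x" | "v = Suc x" | "v \<in> crossings D" unfolding cE by blast
      then show "over E' (h v) = over E v"
      proof cases
        case 3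
        then show ?thesis using hD ov ov'[OF g_mem] g by (simp add: diagram_iso_def)
      qed (simp_all add: h_def E_def E'_def)
    qed
  qed
  then have "p E x = p E' (h x)"
    by (rule p_iso[OF R2_knot_up[OF D R2]]) (simp add: cE)
  then show ?thesis using p p' by (simp add: h_def)
qed

lemma arc_value_wrap:
  assumes D: "D \<in> K" and c: "code D = A @ B" and c': "code D = A' @ B'" and rot: "B' @ A' = B @ A"
  shows "arc_value D A B = arc_value D A' B'"
proof (rule arc_value_iso[OF D _ c c'])
  show "diagram_iso id D D"
    unfolding diagram_iso_def using knot_wf[OF D] by (auto intro!: exI[of _ 0] simp: map_prod.id)
  show "B' @ A' = map (map_prod id id) (B @ A)" using rot by (simp add: map_prod.id)
qed

definition before :: "diagram \<Rightarrow> passage \<Rightarrow> 'a" where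
  "before D x = parity_cycle p D (before_arc D x)"

definition after :: "diagram \<Rightarrow> passage \<Rightarrow> 'a" where
  "after D x = parity_cycle p D (after_arc D x)"

lemma before_eq:
  assumes D: "D \<in> K" and c: "code D = A @ x # B"
  shows "before D x = arc_value D A (x # B)"
proof -
  have d: "distinct (code D)" using knot_wf[OF D] by (simp add: wf_diagram_iff)
  note b = before_arc_eq[OF d c]
  show ?thesis
  proof (cases "A = []")
    case True
    \<comment> \<open>The arc that enters the first passage is the last one, whose insertions are made at the end of the code.\<close>
    have "before D x = arc_value D (code D) []"
      using b True parity_cycle_eq[OF D, of "length B"] by (simp add: before_def arcs_def c)
    also have "\<dots> = arc_value D A (x # B)"
      by (rule arc_value_wrap[OF D]) (simp_all add: c True)
    finally show ?thesis .
  next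
    case False
    then have "Suc (length A - 1) = length A" by simp
    then have "parity_cycle p D (length A - 1) = arc_value D (take (length A) (code D)) (drop (length A) (code D))"
      using parity_cycle_eq[OF D, of "length A - 1"] by (simp add: arcs_def c)
    then show ?thesis using b False by (simp add: before_def c)
  qed
qed

lemma after_eq:
  assumes D: "D \<in> K" and c: "code D = A @ x # B"
  shows "after D x = arc_value D (A @ [x]) B"
proof -
  have d: "distinct (code D)" using knot_wf[OF D] by (simp add: wf_diagram_iff)
  have "length A \<in> arcs D" by (simp add: arcs_def c)
  from parity_cycle_eq[OF D this] show ?thesis
    by (simp add: after_def after_arc_eq[OF d c]) (simp add: c)
qed

lemma follows_after_before: "D \<in> K \<Longrightarrow> follows D x y \<Longrightarrow> after D x = before D y"
  by (simp add: after_def before_def follows_arc knot_wf)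

end


section \<open>Conservation at a crossing\<close>

lemma crossing_split:
  assumes "wf_diagram D" "v \<in> crossings D"
  obtains s A B C where "code D = A @ (v, s) # B @ (v, other s) # C"
proof -
  have "(v, SWNE) \<in> set (code D)" "(v, SENW) \<in> set (code D)"
    using assms wf_passages by auto
  then obtain A R where AR: "code D = A @ (v, SWNE) # R" "(v, SENW) \<in> set A \<union> set R"
    by (metis (no_types, lifting) Un_iff prod.inject set_ConsD set_append split_list strand.distinct(1))
  from AR(2) show ?thesis
  proof
    assume "(v, SENW) \<in> set A"
    then obtain A1 A2 where "A = A1 @ (v, SENW) # A2" by (meson split_list)
    then show ?thesis using AR(1) that[of A1 SENW A2 R] by simp
  next
    assume "(v, SENW) \<in> set R"
    then obtain R1 R2 where "R = R1 @ (v, SENW) # R2" by (meson split_list)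
    then show ?thesis using AR(1) that[of A SWNE R1 R2] by simp
  qed
qed

context parity
begin

text \<open>
  A bigon formed by \<open>v\<close> and one of two inserted crossings makes the values there opposite, provided
  that the heights fit; this fixes the height of the inserted pair. The values at the two inserted
  crossings are opposite as well.
\<close>

lemma pair_value_cancel:
  assumes D: "D \<in> K" "template_of D T" and ij: "i \<noteq> j" "{Inr i, Inr j} \<subseteq> set T"
    and v: "v \<in> crossings D"
  shows "(\<And>x y E. code E = fill (pair_word par i j s x y) T \<Longrightarrow> bigon E y v) \<Longrightarrow>
      pair_value D T par i j s (over D v) = p D v"
    and "(\<And>x y E. code E = fill (pair_word par i j s x y) T \<Longrightarrow> bigon E x v) \<Longrightarrow>
      pair_value D T par i j s (other (over D v)) = - p D v"
proof -
  define x where "x = fresh D"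
  define E where "E h = dia (fill (pair_word par i j s x (Suc x)) T)
    ((over D)(x := h, Suc x := other h))" for h
  have xy: "x \<noteq> Suc x" "{x, Suc x} \<inter> crossings D = {}"
    using Suc_fresh_notin[of D] by (auto simp: x_def)
  have val: "pair_value D T par i j s h = p (E h) x" for h
    by (simp add: pair_value_def E_def x_def Let_def)
  have R2: "R2_dec (E h) x (Suc x) D" for h
    by (rule pair_R2[OF knot_wf[OF D(1)] D(2) ij xy, where par = par and s = s])
      (use xy in \<open>auto simp: E_def\<close>)
  have EK: "E h \<in> K" for h by (rule R2_knot_up[OF D(1) R2])
  have xy_sum: "p (E h) x + p (E h) (Suc x) = 0" for h by (rule p_R2[OF EK R2])
  have pv: "p (E h) v = p D v" for h by (rule p_R2_other[OF D(1) R2 v])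
  have ov: "over (E h) v = over D v" for h using v xy by (auto simp: E_def)
  have cancel: "p (E h) u + p D v = 0"
    if "bigon (E h) u v" "over (E h) u = other (over D v)" "u \<in> {x, Suc x}" for h u
  proof -
    have "R2_dec (E h) u v (dia (filter (\<lambda>z. fst z \<notin> {u, v}) (code (E h))) (over (E h)))"
      by (rule R2_decI) (use R2[of h] that ov[of h] v xy in \<open>auto simp: R2_dec_def\<close>)
    then show ?thesis using p_R2[OF EK] pv by metis
  qed
  show "pair_value D T par i j s (over D v) = p D v"
    if "\<And>x y E. code E = fill (pair_word par i j s x y) T \<Longrightarrow> bigon E y v"
  proof -
    have "p (E (over D v)) (Suc x) + p D v = 0"
      by (rule cancel) (use that[of "E (over D v)" x "Suc x"] in \<open>simp_all add: E_def\<close>)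
    then show ?thesis
      using xy_sum[of "over D v"] unfolding val by (metis add.commute add_left_imp_eq)
  qed
  show "pair_value D T par i j s (other (over D v)) = - p D v"
    if "\<And>x y E. code E = fill (pair_word par i j s x y) T \<Longrightarrow> bigon E x v"
  proof -
    have "p (E (other (over D v))) x + p D v = 0"
      by (rule cancel) (use that[of "E (other (over D v))" x "Suc x"] in \<open>simp_all add: E_def\<close>)
    then show ?thesis unfolding val by (simp add: eq_neg_iff_add_eq_0)
  qed
qed

text \<open>
  There are four ways to insert a pair next to \<open>v\<close> such that \<open>v\<close> belongs to a bigon, one for each
  quadrant. With \<open>in\<close>, \<open>out\<close> for the legs of the strand \<open>s\<close> and \<open>in'\<close>, \<open>out'\<close> for those of the other one
  they give
  \<open>p v = R(in, in') = - R(out', out) = Q(in, out') = Q'(in', out)\<close>,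
  where \<open>Q'\<close> is the mirror image of \<open>Q\<close>. Now the triangle relation is applied to triples of legs: by it
  \<open>R(out', out') - R(out', in)\<close> and \<open>R(out, out) - R(in', out)\<close> are both \<open>p v\<close>, and
  \<open>R(out', in) - R(in, in)\<close> and \<open>R(in', in') - R(in', out)\<close> differ from \<open>- p v\<close> and \<open>p v\<close> by the same
  amount \<open>R(in, out)\<close>.
\<close>

lemma conservation_split:
  assumes D: "D \<in> K" and c: "code D = A @ (v, s) # B @ (v, other s) # C"
  shows "before D (v, s) + before D (v, other s) = after D (v, s) + after D (v, other s)"
proof -
  let ?s = "other s"
  \<comment> \<open>Two slots on each leg, because the coefficient of a leg is the value of a pair inserted on it twice.\<close>
  define T :: template where "T = map Inl A @ [Inr 0, Inr 1, Inl (v, s), Inr 2, Inr 3] @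
    map Inl B @ [Inr 4, Inr 5, Inl (v, ?s), Inr 6, Inr 7] @ map Inl C"
  have "distinct (code D)" using knot_wf[OF D] by (simp add: wf_diagram_iff)
  then have T: "template_of D T"
    by (auto simp: template_of_def T_def c distinct_map inj_on_def)
  have v: "v \<in> crossings D" by (auto simp: crossings_def c)
  have slots: "Inr k \<in> set T" if "k \<in> {0, 1, 2, 3, 4, 5, 6, 7}" for k
    using that by (auto simp: T_def)
  define R where "R = (\<lambda>i j. pair_value D T True i j s SWNE)"
  have height: "pair_value D T par i j t h = pair_value D T par i j t SWNE"
    if "i \<in> {0, 1, 2, 3, 4, 5, 6, 7}" "j \<in> {0, 1, 2, 3, 4, 5, 6, 7}" "i \<noteq> j" for par i j t h
  proof -
    have "\<exists>k \<in> {0, 1, 2}. k \<noteq> i \<and> k \<noteq> j" by (cases "i = 0"; cases "j = 0"; cases "i = 1"; cases "j = 1") auto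
    then obtain k where "k \<in> {0, 1, 2}" "k \<noteq> i" "k \<noteq> j" by blast
    moreover from this have "k \<in> {0, 1, 2, 3, 4, 5, 6, 7}" by blast
    ultimately show ?thesis
      by (intro height_irrelevant[OF D T, of i k j]) (use that slots[OF that(1)] slots[OF that(2)] slots[of k] in simp_all)
  qed
  have swap: "pair_value D T True i j ?s h = R j i"
    if "i \<in> {0, 1, 2, 3, 4, 5, 6, 7}" "j \<in> {0, 1, 2, 3, 4, 5, 6, 7}" "i \<noteq> j" for i j h
    using pair_value_swap[of j i D T s SWNE] height[OF that, of True ?s h] that(3) by (simp add: R_def)
  have Qs: "R i k - R i j = pair_value D T False j k s SWNE"
    if "i \<in> {0, 1, 2, 3, 4, 5, 6, 7}" "j \<in> {0, 1, 2, 3, 4, 5, 6, 7}" "k \<in> {0, 1, 2, 3, 4, 5, 6, 7}"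
      "distinct [i, j, k]" for i j k
    using triangle_relation[OF D T that(4), of SWNE SWNE SWNE s] slots that by (simp add: R_def)
  have Qs': "R k i - R j i = pair_value D T False j k ?s SWNE"
    if "i \<in> {0, 1, 2, 3, 4, 5, 6, 7}" "j \<in> {0, 1, 2, 3, 4, 5, 6, 7}" "k \<in> {0, 1, 2, 3, 4, 5, 6, 7}"
      "distinct [i, j, k]" for i j k
    using triangle_relation[OF D T that(4), of SWNE SWNE SWNE ?s] slots that swap[of i k] swap[of i j]
    by simp
  note upd = T_def pair_word_def
  have r1: "R 1 5 = p D v"
  proof -
    have "pair_value D T True 1 5 s (over D v) = p D v"
    proof (rule pair_value_cancel(1)[OF D T _ _ v])
      fix x y and E :: diagram assume E: "code E = fill (pair_word True 1 5 s x y) T"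
      have "follows E (y, ?s) (v, s)"
        by (rule followsI[of _ "A @ [(x, s)]" _ _ "B @ [(x, ?s), (y, s), (v, ?s)] @ C"]) (simp add: E upd)
      moreover have "follows E (y, s) (v, ?s)"
        by (rule followsI[of _ "A @ [(x, s), (y, ?s), (v, s)] @ B @ [(x, ?s)]" _ _ C]) (simp add: E upd)
      ultimately show "bigon E y v" unfolding bigon_def by (metis other_other)
    qed (simp_all add: slots)
    then show ?thesis using height[of 1 5 True s "over D v"] by (simp add: R_def)
  qed
  have r2: "R 7 3 = - p D v"
  proof -
    have "pair_value D T True 7 3 s (other (over D v)) = - p D v"
    proof (rule pair_value_cancel(2)[OF D T _ _ v])
      fix x y and E :: diagram assume E: "code E = fill (pair_word True 7 3 s x y) T"
      have "follows E (v, s) (x, ?s)"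
        by (rule followsI[of _ A _ _ "(y, s) # B @ [(v, ?s), (x, s), (y, ?s)] @ C"]) (simp add: E upd)
      moreover have "follows E (v, ?s) (x, s)"
        by (rule followsI[of _ "A @ [(v, s), (x, ?s), (y, s)] @ B" _ _ "(y, ?s) # C"]) (simp add: E upd)
      ultimately show "bigon E x v" unfolding bigon_def by (metis other_other)
    qed (simp_all add: slots)
    then show ?thesis using height[of 7 3 True s "other (over D v)"] by (simp add: R_def)
  qed
  have r3: "pair_value D T False 0 6 s SWNE = p D v"
  proof -
    have "pair_value D T False 0 6 s (over D v) = p D v"
    proof (rule pair_value_cancel(1)[OF D T _ _ v])
      fix x y and E :: diagram assume E: "code E = fill (pair_word False 0 6 s x y) T"
      have "follows E (y, ?s) (v, s)"
        by (rule followsI[of _ "A @ [(x, s)]" _ _ "B @ [(v, ?s), (y, s), (x, ?s)] @ C"]) (simp add: E upd)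
      moreover have "follows E (v, ?s) (y, s)"
        by (rule followsI[of _ "A @ [(x, s), (y, ?s), (v, s)] @ B" _ _ "(x, ?s) # C"]) (simp add: E upd)
      ultimately show "bigon E y v" unfolding bigon_def by (metis other_other)
    qed (simp_all add: slots)
    then show ?thesis using height[of 0 6 False s "over D v"] by simp
  qed
  have r4: "pair_value D T False 4 2 ?s SWNE = p D v"
  proof -
    have "pair_value D T False 4 2 ?s (over D v) = p D v"
    proof (rule pair_value_cancel(1)[OF D T _ _ v])
      fix x y and E :: diagram assume E: "code E = fill (pair_word False 4 2 ?s x y) T"
      have "follows E (y, s) (v, ?s)"
        by (rule followsI[of _ "A @ [(v, s), (y, ?s), (x, s)] @ B @ [(x, ?s)]" _ _ C]) (simp add: E upd)
      moreover have "follows E (v, s) (y, ?s)"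
        by (rule followsI[of _ A _ _ "(x, s) # B @ [(x, ?s), (y, s), (v, ?s)] @ C"]) (simp add: E upd)
      ultimately show "bigon E y v" unfolding bigon_def by (metis other_other)
    qed (simp_all add: slots)
    then show ?thesis using height[of 4 2 False ?s "over D v"] by simp
  qed
  have "before D (v, s) = R 1 0"
  proof -
    have "R 1 0 = pair_value D T True 0 1 ?s SWNE" using swap[of 0 1] by simp
    also have "\<dots> = pair_value D (map Inl A @ map Inr [0, 1] @ map Inl ((v, s) # B @ (v, ?s) # C)) True 0 1 ?s SWNE"
      by (rule pair_value_cong) (simp add: upd)
    also have "\<dots> = arc_value D A ((v, s) # B @ (v, ?s) # C)"
      by (rule arc_value_pair_value[OF D c])
    finally show ?thesis using before_eq[OF D c] by simp
  qed
  moreover have "before D (v, ?s) = R 4 5"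
  proof -
    have c': "code D = (A @ (v, s) # B) @ (v, ?s) # C" by (simp add: c)
    have "R 4 5 = pair_value D (map Inl (A @ (v, s) # B) @ map Inr [0, 1] @ map Inl ((v, ?s) # C)) True 0 1 s SWNE"
      unfolding R_def by (rule pair_value_cong) (simp add: upd)
    also have "\<dots> = arc_value D (A @ (v, s) # B) ((v, ?s) # C)"
      by (rule arc_value_pair_value[OF D c'])
    finally show ?thesis using before_eq[OF D c'] by simp
  qed
  moreover have "after D (v, s) = R 2 3"
  proof -
    have c': "code D = (A @ [(v, s)]) @ B @ (v, ?s) # C" by (simp add: c)
    have "R 2 3 = pair_value D (map Inl (A @ [(v, s)]) @ map Inr [0, 1] @ map Inl (B @ (v, ?s) # C)) True 0 1 s SWNE"
      unfolding R_def by (rule pair_value_cong) (simp add: upd)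
    also have "\<dots> = arc_value D (A @ [(v, s)]) (B @ (v, ?s) # C)"
      by (rule arc_value_pair_value[OF D c'])
    finally show ?thesis using after_eq[OF D c] by simp
  qed
  moreover have "after D (v, ?s) = R 7 6"
  proof -
    have c': "code D = (A @ (v, s) # B @ [(v, ?s)]) @ C" by (simp add: c)
    have c'': "code D = (A @ (v, s) # B) @ (v, ?s) # C" by (simp add: c)
    have "R 7 6 = pair_value D T True 6 7 ?s SWNE" using swap[of 6 7] by simp
    also have "\<dots> = pair_value D (map Inl (A @ (v, s) # B @ [(v, ?s)]) @ map Inr [0, 1] @ map Inl C) True 0 1 ?s SWNE"
      by (rule pair_value_cong) (simp add: upd)
    also have "\<dots> = arc_value D (A @ (v, s) # B @ [(v, ?s)]) C"
      by (rule arc_value_pair_value[OF D c'])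
    finally show ?thesis using after_eq[OF D c''] by simp
  qed
  moreover have "R 1 0 + R 4 5 = R 2 3 + R 7 6"
  proof -
    have "R 7 6 = p D v + R 7 0" using Qs[of 7 0 6] r3 by (simp add: algebra_simps)
    moreover have "R 2 3 = p D v + R 4 3" using Qs'[of 3 4 2] r4 by (simp add: algebra_simps)
    moreover have "R 7 0 = R 1 0 + (R 7 3 - R 1 3)"
      using Qs'[of 0 1 7] Qs'[of 3 1 7] by (simp add: algebra_simps)
    moreover have "R 4 3 = R 4 5 - (R 1 5 - R 1 3)"
      using Qs[of 4 3 5] Qs[of 1 3 5] by (simp add: algebra_simps)
    moreover have "r10 + r45 = r23 + r76"
      if "r76 = q + r70" "r23 = q + r43" "r70 = r10 + (r73 - r13)" "r43 = r45 - (r15 - r13)" "r15 = q" "r73 = - q"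
      for r76 q r70 r23 r43 r10 r73 r13 r45 r15 :: 'a
      unfolding that by (simp add: algebra_simps)
    ultimately show ?thesis using r1 r2 by metis
  qed
  ultimately show ?thesis by simp
qed

lemma conservation:
  assumes "D \<in> K" "v \<in> crossings D"
  shows "before D (v, s) + before D (v, other s) = after D (v, s) + after D (v, other s)"
proof -
  obtain t A B C where "code D = A @ (v, t) # B @ (v, other t) # C"
    by (rule crossing_split[OF knot_wf[OF assms(1)] assms(2)])
  from conservation_split[OF assms(1) this] show ?thesis
    by (cases "s = t") (auto simp: neq_strand_iff add.commute)
qed

end


section \<open>The parity cycle away from a move\<close>

definition insert_pair :: "diagram \<Rightarrow> passage list \<Rightarrow> passage list \<Rightarrow> nat \<Rightarrow> nat \<Rightarrow> diagram" where
  "insert_pair D A B x y = dia (A @ [(x, SWNE), (y, SENW), (x, SENW), (y, SWNE)] @ B)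
     ((over D)(x := SWNE, y := SENW))"

lemma insert_deletes:
  assumes "deletes D S D'" "code D = A @ B" "{x, y} \<inter> S = {}" "{x, y} \<inter> crossings D = {}"
  shows "deletes (insert_pair D A B x y) S
    (insert_pair D' (filter (\<lambda>z. fst z \<notin> S) A) (filter (\<lambda>z. fst z \<notin> S) B) x y)"
  using assms unfolding deletes_def by (auto simp: insert_pair_def crossings_def)

lemma bigon_insert:
  assumes "bigon D v w" "code D = A @ B" "code E = A @ W @ B"
    and "fst (last (B @ A)) \<notin> {v, w} \<or> fst (hd (B @ A)) \<notin> {v, w}"
  shows "bigon E v w"
proof -
  have "follows E a b" if "follows D a b" "fst a \<in> {v, w}" "fst b \<in> {v, w}" for a b
    by (rule follows_insert[OF that(1) assms(2,3)]) (use that assms(4) in auto)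
  then show ?thesis using assms(1) unfolding bigon_def by (metis fst_conv insertI1 insertI2)
qed

lemma bigon_sym: "bigon D v w \<Longrightarrow> bigon D w v"
  unfolding bigon_def by (metis other_other)

lemma R2_dec_sym: "R2_dec D v w D' \<Longrightarrow> R2_dec D w v D'"
  unfolding R2_dec_iff using bigon_sym by (auto simp: insert_commute)

lemma side_iff:
  "side D c d \<longleftrightarrow> incoming (clockwise (snd c)) \<noteq> incoming (snd d) \<and>
     (if incoming (snd d) then follows D (side_start c) (side_end d)
      else follows D (side_end d) (side_start c))"
  unfolding side_def joined_def side_start_def side_end_def by (auto split: prod.splits)

text \<open>
  A side persists under insertions at every point off its interior. Which end comes first depends on
  the direction of travel, hence the case distinction.
\<close>

lemma side_insert:
  assumes "side D c d" "code D = A @ B" "code E = A @ W @ B"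
    and "if incoming (snd d) then last (B @ A) \<noteq> side_start c \<or> hd (B @ A) \<noteq> side_end d
       else last (B @ A) \<noteq> side_end d \<or> hd (B @ A) \<noteq> side_start c"
  shows "side E c d"
  using assms(1,4) follows_insert[OF _ assms(2,3)] unfolding side_iff by (auto split: if_splits)

lemma side_start_neq_end: "side_start c \<noteq> side_end c"
  by (cases c; cases "snd c") (auto simp: side_start_def side_end_def)

lemma fst_side [simp]: "fst (side_start c) = fst c" "fst (side_end c) = fst c"
  by (simp_all add: side_start_def side_end_def)

definition R3_perm :: "corner \<Rightarrow> corner \<Rightarrow> corner \<Rightarrow> passage \<Rightarrow> passage" where
  "R3_perm x y z = transpose (side_start x) (side_end y) \<circ>
     transpose (side_start y) (side_end z) \<circ> transpose (side_start z) (side_end x)"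

lemma R3_code: "R3 D x y z D' \<Longrightarrow> code D' = map (R3_perm x y z) (code D)"
  by (simp add: R3_def R3_perm_def)

lemma R3_crossings:
  assumes "R3 D x y z D'"
  shows "crossings D' = crossings D"
proof -
  have "set (code D') = set (code D)"
    by (rule wf_map_transpose(2)[of D "side_start x" "side_end y" "side_start y" "side_end z" "side_start z" "side_end x"])
       (use assms side_set[of D x y] side_set[of D y z] side_set[of D z x] in \<open>simp_all add: R3_def\<close>)
  then show ?thesis by (simp add: crossings_def)
qed

lemma R3_perm_side:
  assumes "distinct [fst x, fst y, fst z]"
  shows "R3_perm x y z (side_start x) = side_end y" "R3_perm x y z (side_end y) = side_start x"
proof -
  have ne: "side_start u \<noteq> side_end u" "side_end u \<noteq> side_start u" for u
    using side_start_neq_end[of u] by auto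
  have ne': "side_start x \<noteq> side_start y" "side_start x \<noteq> side_start z" "side_start x \<noteq> side_end y" "side_start x \<noteq> side_end z"
    "side_end y \<noteq> side_start x" "side_end y \<noteq> side_start z" "side_end y \<noteq> side_end x" "side_end y \<noteq> side_end z"
    using assms fst_side by (metis distinct_length_2_or_more)+
  show "R3_perm x y z (side_start x) = side_end y" "R3_perm x y z (side_end y) = side_start x"
    by (simp_all add: R3_perm_def transpose_def ne ne')
qed

lemma R3_perm_rotate:
  assumes "distinct [fst x, fst y, fst z]"
  shows "R3_perm y z x = R3_perm x y z"
proof -
  have ne: "side_start u \<noteq> side_end u" "side_end u \<noteq> side_start u" for u
    using side_start_neq_end[of u] by auto
  have fst: "side_start u \<noteq> side_start w \<and> side_start u \<noteq> side_end w \<and> side_end u \<noteq> side_start w \<and> side_end u \<noteq> side_end w"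
    if "fst u \<noteq> fst w" for u w
    using that fst_side by metis
  have xyz: "fst x \<noteq> fst y" "fst y \<noteq> fst z" "fst z \<noteq> fst x" "fst y \<noteq> fst x" "fst z \<noteq> fst y" "fst x \<noteq> fst z"
    using assms by auto
  note ne' = xyz[THEN fst]
  have "R3_perm y z x u = R3_perm x y z u" for u
    unfolding R3_perm_def comp_def
    by (cases "u \<in> {side_start x, side_start y, side_start z, side_end x, side_end y, side_end z}")
      (auto simp: transpose_def ne ne')
  then show ?thesis by blast
qed

lemma R3_perm_other: "fst u \<notin> {fst x, fst y, fst z} \<Longrightarrow> R3_perm x y z u = u"
  by (auto simp: R3_perm_def transpose_def)

text \<open>
  The three transpositions move disjoint pairs of passages, so they commute and the corners may be
  permuted cyclically.
\<close>

lemma R3_rotate: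
  assumes "R3 D x y z D'"
  shows "R3 D y z x D'"
proof -
  have "distinct [fst x, fst y, fst z]" using assms by (simp add: R3_def)
  then have "code D' = map (R3_perm y z x) (code D)"
    using R3_code[OF assms] R3_perm_rotate by metis
  then show ?thesis
    using assms unfolding R3_def R3_perm_def by auto
qed

lemma follows_map:
  assumes "follows D a b" "code E = map f (code D)"
  shows "follows E (f a) (f b)"
proof -
  obtain i where i: "i < length (code D)" "code D ! i = a" "code D ! (Suc i mod length (code D)) = b"
    using assms(1) by (auto simp: follows_def)
  moreover from this have "Suc i mod length (code D) < length (code D)"
    by (intro mod_less_divisor) auto
  ultimately show ?thesis
    unfolding follows_def assms(2) by (intro exI[of _ i]) simp
qed

text \<open>
  A rotation of a list without repetitions is determined by its first element.
\<close>

lemma rotate_same_start: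
  assumes "distinct xs" "xs = A @ y # B" "rotate k xs = A' @ y # B'"
  shows "B' @ A' = B @ A"
proof -
  have A': "rotate (length A') (rotate k xs) = y # B' @ A'"
    unfolding assms(3) by (simp add: rotate_append)
  define m where "m = (length A' + k) mod length xs"
  have "xs \<noteq> []" using assms(2) by simp
  have "rotate m xs = y # B' @ A'"
    using A' by (simp add: m_def rotate_rotate flip: rotate_conv_mod)
  then have "xs ! m = y"
    using hd_rotate_conv_nth[OF \<open>xs \<noteq> []\<close>, of m] by (simp add: m_def)
  moreover have "xs ! length A = y" "length A < length xs" using assms(2) by auto
  ultimately have "m = length A"
    using nth_eq_iff_index_eq[OF assms(1), of m "length A"] \<open>xs \<noteq> []\<close> by (simp add: m_def)
  then have "y # B' @ A' = rotate (length A) (A @ y # B)"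
    using \<open>rotate m xs = y # B' @ A'\<close> assms(2) by simp
  also have "\<dots> = y # B @ A" by (simp add: rotate_append)
  finally show ?thesis by simp
qed

context parity
begin

text \<open>
  If the same pair can be inserted before and after a move and the move still applies, the values
  there agree by invariance of the parity. For the Reidemeister moves this holds as long as the
  insertion point is not inside a side of the region involved.
\<close>

lemma arc_value_move:
  assumes D: "D \<in> K" "code D = A @ B" and D': "D' \<in> K" "code D' = A' @ B'"
    and sub: "crossings D' \<subseteq> crossings D"
    and move: "\<And>x y. x \<noteq> y \<Longrightarrow> {x, y} \<inter> crossings D = {} \<Longrightarrow> wf_diagram (insert_pair D A B x y) \<Longrightarrow>
      wf_diagram (insert_pair D' A' B' x y) \<Longrightarrow>
      \<exists>f S. move (insert_pair D A B x y) (insert_pair D' A' B' x y) f S \<and> f x = Some x"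
  shows "arc_value D A B = arc_value D' A' B'"
proof -
  obtain x y where xy: "x \<noteq> y" "{x, y} \<inter> crossings D = {}"
  proof
    show "fresh D \<noteq> Suc (fresh D)" "{fresh D, Suc (fresh D)} \<inter> crossings D = {}"
      using Suc_fresh_notin[of D] by auto
  qed
  have xy': "{x, y} \<inter> crossings D' = {}" using xy sub by blast
  let ?E = "insert_pair D A B x y" and ?E' = "insert_pair D' A' B' x y"
  have ov: "over ?E u = over D u" if "u \<in> crossings D" for u
    using that xy by (auto simp: insert_pair_def)
  have ov': "over ?E' u = over D' u" if "u \<in> crossings D'" for u
    using that xy' by (auto simp: insert_pair_def)
  have E: "R2_dec ?E x y D" "p ?E x = arc_value D A B"
    using self_pair[OF D xy _ ov, where s = SWNE] xy by (simp_all add: insert_pair_def)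
  have E': "R2_dec ?E' x y D'" "p ?E' x = arc_value D' A' B'"
    using self_pair[OF D' xy(1) xy' _ ov', where s = SWNE] xy by (simp_all add: insert_pair_def)
  have "wf_diagram ?E" "wf_diagram ?E'" using E(1) E'(1) by (simp_all add: R2_dec_def)
  then obtain f S where f: "move ?E ?E' f S" "f x = Some x"
    using move[OF xy] by blast
  have "x \<in> crossings ?E" by (simp add: crossings_def insert_pair_def)
  then have "p ?E x = p ?E' x"
    using p_move[OF R2_knot_up[OF D(1) E(1)] f(1) _ f(2)] by blast
  then show ?thesis using E(2) E'(2) by simp
qed

lemma arc_value_R1:
  assumes D: "D \<in> K" "code D = A @ B" and R1: "R1_dec D v D'"
    and pt: "fst (last (B @ A)) \<noteq> v \<or> fst (hd (B @ A)) \<noteq> v"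
  shows "arc_value D A B = arc_value D' (filter (\<lambda>z. fst z \<notin> {v}) A) (filter (\<lambda>z. fst z \<notin> {v}) B)"
proof (rule arc_value_move[OF D])
  have del: "deletes D {v} D'" using R1 by (simp add: R1_dec_def)
  show "D' \<in> K" by (rule knot_move[OF D(1) move.R1_decreasing[OF R1]])
  show "code D' = filter (\<lambda>z. fst z \<notin> {v}) A @ filter (\<lambda>z. fst z \<notin> {v}) B"
    using del D(2) by (simp add: deletes_def)
  show "crossings D' \<subseteq> crossings D" using deletes_crossings[OF del] by auto
  fix x y
  let ?E = "insert_pair D A B x y"
  let ?E' = "insert_pair D' (filter (\<lambda>z. fst z \<notin> {v}) A) (filter (\<lambda>z. fst z \<notin> {v}) B) x y"
  assume xy: "x \<noteq> y" "{x, y} \<inter> crossings D = {}" and wf: "wf_diagram ?E" "wf_diagram ?E'"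
  obtain t where t: "follows D (v, t) (v, other t)" using R1 by (auto simp: R1_dec_iff)
  have "v \<in> crossings D" using follows_set[OF t] code_crossings by blast
  then have "deletes ?E {v} ?E'"
    by (intro insert_deletes[OF del D(2)]) (use xy in auto)
  moreover have "follows ?E (v, t) (v, other t)"
    by (rule follows_insert[OF t D(2)]) (use pt in \<open>auto simp: insert_pair_def\<close>)
  ultimately have "R1_dec ?E v ?E'"
    using wf unfolding R1_dec_iff by blast
  then show "\<exists>f S. move ?E ?E' f S \<and> f x = Some x"
    by (intro exI conjI, rule move.R1_decreasing) (simp_all add: crossings_def insert_pair_def)
qed

lemma arc_value_R2:
  assumes D: "D \<in> K" "code D = A @ B" and R2: "R2_dec D v w D'"
    and pt: "\<And>E W. code E = A @ W @ B \<Longrightarrow> bigon E v w"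
  shows "arc_value D A B = arc_value D' (filter (\<lambda>z. fst z \<notin> {v, w}) A) (filter (\<lambda>z. fst z \<notin> {v, w}) B)"
proof (rule arc_value_move[OF D])
  have del: "deletes D {v, w} D'" using R2 by (simp add: R2_dec_def)
  show "D' \<in> K" by (rule R2_knot_down[OF D(1) R2])
  show "code D' = filter (\<lambda>z. fst z \<notin> {v, w}) A @ filter (\<lambda>z. fst z \<notin> {v, w}) B"
    using del D(2) by (simp add: deletes_def)
  show "crossings D' \<subseteq> crossings D" using deletes_crossings[OF del] by auto
  fix x y
  let ?E = "insert_pair D A B x y"
  let ?E' = "insert_pair D' (filter (\<lambda>z. fst z \<notin> {v, w}) A) (filter (\<lambda>z. fst z \<notin> {v, w}) B) x y"
  assume xy: "x \<noteq> y" "{x, y} \<inter> crossings D = {}" and wf: "wf_diagram ?E" "wf_diagram ?E'"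
  have "bigon D v w" using R2 by (simp add: R2_dec_iff)
  then have vw: "v \<in> crossings D" "w \<in> crossings D"
    using follows_set code_crossings unfolding bigon_def by metis+
  then have "deletes ?E {v, w} ?E'"
    by (intro insert_deletes[OF del D(2)]) (use xy in auto)
  moreover have "bigon ?E v w" by (rule pt) (simp add: insert_pair_def)
  moreover have "over ?E v = over D v" "over ?E w = over D w"
    using vw xy by (auto simp: insert_pair_def)
  ultimately have "R2_dec ?E v w ?E'"
    using wf R2 unfolding R2_dec_iff by simp
  then show "\<exists>f S. move ?E ?E' f S \<and> f x = Some x"
    by (intro exI conjI, rule move.R2_decreasing) (simp_all add: crossings_def insert_pair_def)
qed

lemma arc_value_R3:
  assumes D: "D \<in> K" "code D = A @ B" and R3: "R3 D x y z D'"
    and pt: "\<And>E W. code E = A @ W @ B \<Longrightarrow> side E x y \<and> side E y z \<and> side E z x"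
  shows "arc_value D A B = arc_value D' (map (R3_perm x y z) A) (map (R3_perm x y z) B)"
proof (rule arc_value_move[OF D])
  show "D' \<in> K" by (rule knot_move[OF D(1) move.R3[OF R3]])
  show "code D' = map (R3_perm x y z) A @ map (R3_perm x y z) B"
    using R3_code[OF R3] D(2) by simp
  have xyz: "fst x \<in> crossings D" "fst y \<in> crossings D" "fst z \<in> crossings D"
    using R3 side_set[of D x y] side_set[of D y z] imageI[of _ "set (code D)" fst] fst_side
    unfolding R3_def crossings_def by metis+
  show "crossings D' \<subseteq> crossings D" using R3_crossings[OF R3] by simp
  fix u w
  let ?E = "insert_pair D A B u w"
  let ?E' = "insert_pair D' (map (R3_perm x y z) A) (map (R3_perm x y z) B) u w"
  assume uw: "u \<noteq> w" "{u, w} \<inter> crossings D = {}" and wf: "wf_diagram ?E" "wf_diagram ?E'"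
  have ov: "over ?E v = over D v" "over ?E' v = over D' v" if "v \<in> crossings D" for v
    using that uw by (auto simp: insert_pair_def)
  have "R3_perm x y z (u, s) = (u, s)" "R3_perm x y z (w, s) = (w, s)" for s
    using uw xyz by (auto intro!: R3_perm_other)
  then have code: "code ?E' = map (R3_perm x y z) (code ?E)"
    by (simp add: insert_pair_def)
  have sides: "side ?E x y" "side ?E y z" "side ?E z x"
    using pt[of ?E] by (auto simp: insert_pair_def)
  have over: "is_over ?E (side_start c) = is_over D (side_start c)" if "fst c \<in> crossings D" for c
    using ov(1)[OF that] by (simp add: is_over_def)
  have same: "over ?E' v = over ?E v" if "v \<in> crossings ?E" for v
  proof (cases "v \<in> crossings D")
    case True
    then show ?thesis using ov R3 by (simp add: R3_def)
  next
    case False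
    then have "v \<in> {u, w}" using that D(2) by (auto simp: crossings_def insert_pair_def)
    then show ?thesis by (auto simp: insert_pair_def)
  qed
  have "R3 ?E x y z ?E'"
    unfolding R3_def
  proof (intro conjI)
    show "code ?E' = map (transpose (side_start x) (side_end y) \<circ> transpose (side_start y) (side_end z) \<circ>
                    transpose (side_start z) (side_end x)) (code ?E)"
      using code by (simp add: R3_perm_def)
    show "\<not> (is_over ?E (side_start x) = is_over ?E (side_start y) \<and>
        is_over ?E (side_start y) = is_over ?E (side_start z))"
      using R3 unfolding over[OF xyz(1)] over[OF xyz(2)] over[OF xyz(3)] R3_def by blast
    show "distinct [fst x, fst y, fst z]" using R3 by (simp add: R3_def)
  qed (use wf sides same in auto)
  then show "\<exists>f S. move ?E ?E' f S \<and> f u = Some u"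
    by (intro exI conjI, rule move.R3) (simp_all add: crossings_def insert_pair_def)
qed

lemma passage_split:
  assumes "D \<in> K" "v \<in> crossings D"
  obtains A B where "code D = A @ (v, s) # B"
  using wf_passages[OF knot_wf[OF assms(1)], of v s] assms(2) by (meson split_list)

text \<open>
  At a crossing that stays out of the move, the points immediately before and after a passage are
  never between two passages of the region.
\<close>

lemma legs_R1:
  assumes D: "D \<in> K" and R1: "R1_dec D u D'" and v: "v \<in> crossings D'"
  shows "before D (v, s) = before D' (v, s) \<and> after D (v, s) = after D' (v, s)"
proof -
  have del: "deletes D {u} D'" using R1 by (simp add: R1_dec_def)
  have D': "D' \<in> K" by (rule knot_move[OF D move.R1_decreasing[OF R1]])
  have vu: "v \<in> crossings D" "v \<noteq> u" using deletes_crossings[OF del] v by auto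
  obtain A B where c: "code D = A @ (v, s) # B" using passage_split[OF D vu(1)] .
  let ?f = "filter (\<lambda>z. fst z \<notin> {u})"
  have c': "code D' = ?f A @ (v, s) # ?f B"
    using del vu(2) by (simp add: deletes_def c)
  have c2: "code D = (A @ [(v, s)]) @ B" using c by simp
  show ?thesis
    using arc_value_R1[OF D c R1] arc_value_R1[OF D c2 R1] vu(2)
    by (simp add: before_eq[OF D c] before_eq[OF D' c'] after_eq[OF D c] after_eq[OF D' c'])
qed

lemma legs_R2:
  assumes D: "D \<in> K" and R2: "R2_dec D u w D'" and v: "v \<in> crossings D'"
  shows "before D (v, s) = before D' (v, s) \<and> after D (v, s) = after D' (v, s)"
proof -
  have del: "deletes D {u, w} D'" and bigon: "bigon D u w" using R2 by (simp_all add: R2_dec_iff)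
  have D': "D' \<in> K" by (rule R2_knot_down[OF D R2])
  have vu: "v \<in> crossings D" "v \<notin> {u, w}" using deletes_crossings[OF del] v by auto
  obtain A B where c: "code D = A @ (v, s) # B" using passage_split[OF D vu(1)] .
  let ?f = "filter (\<lambda>z. fst z \<notin> {u, w})"
  have c': "code D' = ?f A @ (v, s) # ?f B"
    using del vu(2) by (simp add: deletes_def c)
  have c2: "code D = (A @ [(v, s)]) @ B" using c by simp
  have "arc_value D A ((v, s) # B) = arc_value D' (?f A) (?f ((v, s) # B))"
    by (rule arc_value_R2[OF D c R2], rule bigon_insert[OF bigon c]) (use vu(2) in auto)
  moreover have "arc_value D (A @ [(v, s)]) B = arc_value D' (?f (A @ [(v, s)])) (?f B)"
    by (rule arc_value_R2[OF D c2 R2], rule bigon_insert[OF bigon c2]) (use vu(2) in auto)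
  ultimately show ?thesis
    using vu(2) by (simp add: before_eq[OF D c] before_eq[OF D' c'] after_eq[OF D c] after_eq[OF D' c'])
qed

lemma legs_R3:
  assumes D: "D \<in> K" and R3: "R3 D x y z D'" and v: "v \<in> crossings D" "v \<notin> {fst x, fst y, fst z}"
  shows "before D (v, s) = before D' (v, s) \<and> after D (v, s) = after D' (v, s)"
proof -
  have D': "D' \<in> K" by (rule knot_move[OF D move.R3[OF R3]])
  obtain A B where c: "code D = A @ (v, s) # B" using passage_split[OF D v(1)] .
  let ?f = "map (R3_perm x y z)"
  have vs: "R3_perm x y z (v, s) = (v, s)" by (rule R3_perm_other) (use v(2) in simp)
  have c': "code D' = ?f A @ (v, s) # ?f B"
    using R3_code[OF R3] vs by (simp add: c)
  have c2: "code D = (A @ [(v, s)]) @ B" using c by simp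
  have sides: "side D x y" "side D y z" "side D z x" using R3 by (simp_all add: R3_def)
  have "(v, s) \<noteq> side_start u \<and> (v, s) \<noteq> side_end u" if "fst u \<noteq> v" for u
    using that fst_side[of u] by (metis fst_conv)
  then have ne: "(v, s) \<noteq> side_start x" "(v, s) \<noteq> side_end x" "(v, s) \<noteq> side_start y"
      "(v, s) \<noteq> side_end y" "(v, s) \<noteq> side_start z" "(v, s) \<noteq> side_end z"
    using v(2) by auto
  have "arc_value D A ((v, s) # B) = arc_value D' (?f A) (?f ((v, s) # B))"
    by (rule arc_value_R3[OF D c R3]) (intro conjI sides[THEN side_insert, OF c]; use ne in simp)
  moreover have "arc_value D (A @ [(v, s)]) B = arc_value D' (?f (A @ [(v, s)])) (?f B)"
    by (rule arc_value_R3[OF D c2 R3]) (intro conjI sides[THEN side_insert, OF c2]; use ne in simp)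
  ultimately show ?thesis
    using vs by (simp add: before_eq[OF D c] before_eq[OF D' c'] after_eq[OF D c] after_eq[OF D' c'])
qed

lemma legs_iso:
  assumes D: "D \<in> K" and g: "diagram_iso g D D'" and v: "v \<in> crossings D"
  shows "before D (v, s) = before D' (g v, s) \<and> after D (v, s) = after D' (g v, s)"
proof -
  have D': "D' \<in> K" by (rule iso_knot[OF D g])
  obtain A B where c: "code D = A @ (v, s) # B" using passage_split[OF D v(1)] .
  obtain k where k: "code D' = rotate k (map (map_prod g id) (code D))"
    using g by (auto simp: diagram_iso_def)
  have "(g v, s) \<in> set (code D')" by (simp add: k c)
  then obtain A' B' where c': "code D' = A' @ (g v, s) # B'" by (meson split_list)
  let ?m = "map (map_prod g id)"
  have "distinct (?m (code D))"
    using knot_wf[OF D'] unfolding wf_diagram_iff k by simp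
  then have rot: "B' @ A' = ?m B @ ?m A"
    by (rule rotate_same_start[of _ "?m A" "(g v, s)" "?m B" k]) (use k c c' in simp_all)
  have c2: "code D = (A @ [(v, s)]) @ B" using c by simp
  have c2': "code D' = (A' @ [(g v, s)]) @ B'" using c' by simp
  have "arc_value D A ((v, s) # B) = arc_value D' A' ((g v, s) # B')"
    by (rule arc_value_iso[OF D g c c']) (simp add: rot)
  moreover have "arc_value D (A @ [(v, s)]) B = arc_value D' (A' @ [(g v, s)]) B'"
    by (rule arc_value_iso[OF D g c2 c2']) (use rot in simp)
  ultimately show ?thesis
    by (simp add: before_eq[OF D c] before_eq[OF D' c'] after_eq[OF D c] after_eq[OF D' c'])
qed

text \<open>
  The segments that enter and leave the bigon along one strand lie on one arc once the bigon is
  removed.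
\<close>

lemma bigon_merge:
  assumes D: "D \<in> K" and R2: "R2_dec D v w D'"
    and f: "follows D (v, t) (w, other t)"
    and f': "follows D (v, other t) (w, t) \<or> follows D (w, t) (v, other t)"
  shows "before D (v, t) = after D (w, other t)"
proof -
  have vw: "v \<noteq> w" and del: "deletes D {v, w} D'" using R2 by (simp_all add: R2_dec_iff)
  have D': "D' \<in> K" by (rule R2_knot_down[OF D R2])
  have persist: "bigon E v w"
    if "code D = A @ B" "code E = A @ W @ B" "hd (B @ A) = (v, t) \<or> last (B @ A) = (w, other t)" for A B E W
  proof -
    have "follows E (v, t) (w, other t)"
      by (rule follows_insert[OF f that(1,2)]) (use that(3) vw in auto)
    moreover have "follows E (v, other t) (w, t) \<or> follows E (w, t) (v, other t)"
      using f'
    proof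
      assume "follows D (v, other t) (w, t)"
      from follows_insert[OF this that(1,2)] show ?thesis using that(3) vw by auto
    next
      assume "follows D (w, t) (v, other t)"
      from follows_insert[OF this that(1,2)] show ?thesis using that(3) vw by auto
    qed
    ultimately show ?thesis unfolding bigon_def by blast
  qed
  let ?f = "filter (\<lambda>z. fst z \<notin> {v, w})"
  show ?thesis
    using f unfolding follows_iff
  proof (elim disjE exE conjE)
    fix P Q assume c: "code D = P @ (v, t) # (w, other t) # Q"
    have c2: "code D = (P @ [(v, t)]) @ (w, other t) # Q"
      and c3: "code D = (P @ [(v, t), (w, other t)]) @ Q" using c by simp_all
    have "before D (v, t) = arc_value D' (?f P) (?f ((v, t) # (w, other t) # Q))"
      unfolding before_eq[OF D c] by (rule arc_value_R2[OF D c R2], rule persist[OF c]) auto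
    moreover have "after D (w, other t) = arc_value D' (?f (P @ [(v, t), (w, other t)])) (?f Q)"
      using after_eq[OF D c2] arc_value_R2[OF D c3 R2, OF persist[OF c3]] by simp
    ultimately show ?thesis by simp
  next
    assume n: "code D \<noteq> []" and l: "last (code D) = (v, t)" and h: "hd (code D) = (w, other t)"
    obtain Z where c: "code D = ((w, other t) # Z) @ [(v, t)]"
      using n l h vw by (cases "code D"; cases "tl (code D)" rule: rev_cases) (auto split: if_splits)
    have c2: "code D = [] @ (w, other t) # Z @ [(v, t)]"
      and c3: "code D = [(w, other t)] @ Z @ [(v, t)]" using c by simp_all
    \<comment> \<open>The side runs through the starting point of the reading: without the bigon, one of the two points is at the end of the code and the other one at its beginning.\<close>
    have "before D (v, t) = arc_value D' (?f ((w, other t) # Z)) (?f [(v, t)])"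
      unfolding before_eq[OF D c] by (rule arc_value_R2[OF D c R2], rule persist[OF c]) auto
    moreover have "after D (w, other t) = arc_value D' (?f [(w, other t)]) (?f (Z @ [(v, t)]))"
      using after_eq[OF D c2] arc_value_R2[OF D c3 R2, OF persist[OF c3]] by simp
    moreover have "arc_value D' (?f Z) [] = arc_value D' [] (?f Z)"
    proof (rule arc_value_wrap[OF D'])
      show "code D' = ?f Z @ []" "code D' = [] @ ?f Z"
        using del by (simp_all add: deletes_def c)
    qed simp
    ultimately show ?thesis by simp
  qed
qed

text \<open>
  A strand that runs along the side of the triangle from \<open>a\<close> to \<open>b\<close> meets these passages in the opposite
  order after the move, while its outer segments, before and after the triangle, are not affected.
\<close>

lemma triangle_legs:
  assumes D: "D \<in> K" and R3: "R3 D x y z D'"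
    and ab: "if incoming (snd y) then a = side_start x \<and> b = side_end y else a = side_end y \<and> b = side_start x"
  shows "after D a = before D b" "after D' b = before D' a"
    "before D a = before D' b" "after D b = after D' a"
proof -
  have D': "D' \<in> K" by (rule knot_move[OF D move.R3[OF R3]])
  have sides: "side D x y" "side D y z" "side D z x" and d: "distinct [fst x, fst y, fst z]"
    using R3 by (simp_all add: R3_def)
  have f: "follows D a b" using sides(1) ab unfolding side_iff by (auto split: if_splits)
  have perm: "R3_perm x y z a = b" "R3_perm x y z b = a"
    using R3_perm_side[OF d] ab by (auto split: if_splits)
  have f': "follows D' b a"
    using follows_map[OF f R3_code[OF R3]] perm by simp
  show "after D a = before D b" "after D' b = before D' a"
    using follows_after_before[OF D f] follows_after_before[OF D' f'] by auto
  have ne: "side_start u \<noteq> side_start w \<and> side_start u \<noteq> side_end w \<and> side_end u \<noteq> side_start w \<and> side_end u \<noteq> side_end w"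
    if "fst u \<noteq> fst w" for u w
    using that fst_side by metis
  have xyz: "fst x \<noteq> fst y" "fst y \<noteq> fst z" "fst z \<noteq> fst x" "fst y \<noteq> fst x" "fst z \<noteq> fst y" "fst x \<noteq> fst z"
    using d by auto
  have ne2: "a \<noteq> b" "a \<notin> {side_start y, side_end z, side_start z, side_end x}"
      "b \<notin> {side_start y, side_end z, side_start z, side_end x}"
    using ab ne xyz side_start_neq_end by (metis insertE empty_iff)+
  have persist: "side E x y \<and> side E y z \<and> side E z x"
    if "code D = A @ B" "code E = A @ W @ B" "hd (B @ A) = a \<or> last (B @ A) = b" for A B E W
    using sides(1)[THEN side_insert, OF that(1,2)] sides(2)[THEN side_insert, OF that(1,2)]
      sides(3)[THEN side_insert, OF that(1,2)] that(3) ne2 ab by (auto split: if_splits)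
  have "a \<in> set (code D)" using follows_set[OF f] by simp
  then obtain A B where c: "code D = A @ a # B" by (meson split_list)
  have c': "code D' = map (R3_perm x y z) A @ b # map (R3_perm x y z) B"
    using R3_code[OF R3] perm by (simp add: c)
  show "before D a = before D' b"
    unfolding before_eq[OF D c] before_eq[OF D' c']
    using arc_value_R3[OF D c R3, OF persist[OF c]] perm by simp
  have "b \<in> set (code D)" using follows_set[OF f] by simp
  then obtain A B where c: "code D = A @ b # B" by (meson split_list)
  have c2: "code D = (A @ [b]) @ B" using c by simp
  have c': "code D' = map (R3_perm x y z) A @ a # map (R3_perm x y z) B"
    using R3_code[OF R3] perm by (simp add: c)
  show "after D b = after D' a"
    unfolding after_eq[OF D c] after_eq[OF D' c']
    using arc_value_R3[OF D c2 R3, OF persist[OF c2]] perm by simp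
qed

end


section \<open>The quasi-index\<close>

context parity
begin

lemma pi_out: "pi_of p D v = after D (v, SWNE) - before D (v, SWNE)"
  by (simp add: pi_of_def after_def before_def leg_arc_before_after)

lemma pi_in:
  assumes "D \<in> K" "v \<in> crossings D"
  shows "pi_of p D v = before D (v, SENW) - after D (v, SENW)"
proof -
  have "before D (v, SWNE) + before D (v, SENW) = after D (v, SWNE) + after D (v, SENW)"
    using conservation[OF assms, of SWNE] by simp
  then show ?thesis unfolding pi_out by (simp add: algebra_simps)
qed

text \<open>
  Conservation at \<open>v\<close> means that \<open>\<pi>\<close> can be computed on either strand.
\<close>

lemma pi_strand:
  assumes "D \<in> K" "v \<in> crossings D"
  shows "pi_of p D v = (if t = SWNE then after D (v, t) - before D (v, t) else before D (v, t) - after D (v, t))"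
  using pi_out pi_in[OF assms] by (cases t) simp_all

lemma pi_move:
  assumes D: "D \<in> K" and move: "move D D' f S" and v: "v \<in> crossings D - S" and w: "f v = Some w"
  shows "pi_of p D v = pi_of p D' w"
proof -
  have D': "D' \<in> K" by (rule knot_move[OF D move])
  have "before D (v, SWNE) = before D' (w, SWNE) \<and> after D (v, SWNE) = after D' (w, SWNE)"
    using move
  proof cases
    case (iso g)
    then have "g v = w" using v w by simp
    then show ?thesis using legs_iso[OF D iso(3)] v by blast
  next
    case (R1_decreasing u)
    then have "w = v" "v \<in> crossings D'" using w by (auto split: if_splits)
    then show ?thesis using legs_R1[OF D R1_decreasing(3)] by blast
  next
    case (R1_increasing u)
    then have "w = v" using v w by simp
    then show ?thesis using legs_R1[OF D' R1_increasing(3)] v by simp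
  next
    case (R2_decreasing u u')
    then have "w = v" "v \<in> crossings D'" using w by (auto split: if_splits)
    then show ?thesis using legs_R2[OF D R2_decreasing(3)] by blast
  next
    case (R2_increasing u u')
    then have "w = v" using v w by simp
    then show ?thesis using legs_R2[OF D' R2_increasing(3)] v by simp
  next
    case (R3 x y z)
    then have "w = v" using v w by simp
    then show ?thesis using legs_R3[OF D R3(3)] v R3(2) by simp
  qed
  then show ?thesis by (simp add: pi_out)
qed

text \<open>
  One strand through the bigon suffices: it has opposite types at \<open>v\<close> and \<open>w\<close>, the arc between them is
  shared, and the outer arcs have the same coefficient.
\<close>

lemma pi_bigon_aux:
  assumes D: "D \<in> K" and R2: "R2_dec D v w D'"
    and f: "follows D (v, t) (w, other t)"
    and f': "follows D (v, other t) (w, t) \<or> follows D (w, t) (v, other t)"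
  shows "pi_of p D v = pi_of p D w"
proof -
  have "v \<in> crossings D" "w \<in> crossings D"
    using follows_set[OF f] code_crossings by auto
  moreover have "before D (v, t) = after D (w, other t)" by (rule bigon_merge[OF assms])
  moreover have "after D (v, t) = before D (w, other t)" by (rule follows_after_before[OF D f])
  ultimately show ?thesis
    using pi_strand[OF D, of v t] pi_strand[OF D, of w "other t"] by (cases t) simp_all
qed

lemma pi_bigon:
  assumes D: "D \<in> K" and R2: "R2_dec D v w D'"
  shows "pi_of p D v = pi_of p D w"
proof -
  have "bigon D v w" using R2 by (simp add: R2_dec_iff)
  then show ?thesis
    unfolding bigon_def
  proof (elim disjE exE conjE)
    fix t assume "follows D (w, t) (v, other t)" "follows D (w, other t) (v, t)"
    then show ?thesis using pi_bigon_aux[OF D R2_dec_sym[OF R2]] by simp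
  qed (use pi_bigon_aux[OF D R2] in blast)+
qed

text \<open>
  Along a strand write \<open>i\<close>, \<open>o\<close> for the coefficients before and after the triangle, which persist, and
  \<open>m\<close>, \<open>m'\<close> for that of the side before and after the move. The passages at its two ends trade places, so
  \<open>\<pi>\<close> changes by \<open>i + o - m - m'\<close> at both ends up to a sign; the sign is \<open>\<epsilon>\<close> times a factor that says on
  which side of the strand the triangle lies, and this factor is common to both ends.
\<close>

lemma pi_triangle_side:
  assumes D: "D \<in> K" and R3: "R3 D x y z D'"
  shows "eps x (pi_of p D' (fst x) - pi_of p D (fst x)) = eps y (pi_of p D' (fst y) - pi_of p D (fst y))"
proof -
  have D': "D' \<in> K" by (rule knot_move[OF D move.R3[OF R3]])
  define a where "a = (if incoming (snd y) then side_start x else side_end y)"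
  define b where "b = (if incoming (snd y) then side_end y else side_start x)"
  have side: "side D x y" using R3 by (simp add: R3_def)
  have legs: "after D a = before D b" "after D' b = before D' a" "before D a = before D' b" "after D b = after D' a"
    using triangle_legs[OF D R3, of a b] by (auto simp: a_def b_def)
  have cD': "crossings D' = crossings D" by (rule R3_crossings[OF R3])
  have mem: "fst x \<in> crossings D" "fst y \<in> crossings D"
    using side_set[OF side] imageI[of _ "set (code D)" fst] fst_side unfolding crossings_def by metis+
  have pi: "pi_of p D v = (if t = SWNE then after D (v, t) - before D (v, t) else before D (v, t) - after D (v, t))"
    "pi_of p D' v = (if t = SWNE then after D' (v, t) - before D' (v, t) else before D' (v, t) - after D' (v, t))"
    if "v \<in> crossings D" for v t
    by (rule pi_strand[OF D that], rule pi_strand[OF D'], simp add: cD' that)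
  have inc: "incoming (clockwise (snd x)) \<noteq> incoming (snd y)"
    using side unfolding side_iff by blast
  show ?thesis
    using legs inc
    unfolding pi[OF mem(1), of "snd (side_start x)"] pi[OF mem(2), of "snd (side_end y)"]
    by (cases x; cases y; cases "snd x"; cases "snd y")
      (simp_all add: a_def b_def eps_def incoming_def side_start_def side_end_def algebra_simps)
qed

lemma eps_eps [simp]: "eps x (eps x a) = a"
  by (simp add: eps_def)

lemma pi_quasi_index: "quasi_index K (pi_of p)"
  unfolding quasi_index_def
proof (intro conjI ballI allI impI)
  fix D D' f S v w
  assume "D \<in> K" "move D D' f S" "v \<in> crossings D - S" "f v = Some w"
  then show "pi_of p D v = pi_of p D' w" by (rule pi_move)
next
  fix D D' v w assume "D \<in> K" "R2_dec D v w D'"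
  then show "pi_of p D v = pi_of p D w" by (rule pi_bigon)
next
  fix D D' x y z assume D: "D \<in> K" and R3: "R3 D x y z D'"
  \<comment> \<open>Adjacent corners have the same signed change, so it is common to all three.\<close>
  define t where "t = eps x (pi_of p D' (fst x) - pi_of p D (fst x))"
  have y: "t = eps y (pi_of p D' (fst y) - pi_of p D (fst y))"
    unfolding t_def by (rule pi_triangle_side[OF D R3])
  have z: "t = eps z (pi_of p D' (fst z) - pi_of p D (fst z))"
    unfolding y by (rule pi_triangle_side[OF D R3_rotate[OF R3]])
  have "pi_of p D' (fst x) = pi_of p D (fst x) + eps x t" unfolding t_def by simp
  moreover have "pi_of p D' (fst y) = pi_of p D (fst y) + eps y t" unfolding y by simp
  moreover have "pi_of p D' (fst z) = pi_of p D (fst z) + eps z t" unfolding z by simp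
  ultimately show "\<exists>t. \<forall>c\<in>{x, y, z}. pi_of p D' (fst c) = pi_of p D (fst c) + eps c t" by blast
qed

end

section \<open>The decomposition of the parity cycle\<close>

lemma cyclic_interval:
  fixes i j n a :: nat
  assumes "i < n" "j < n" "i \<noteq> j" "a < n"
  shows "a \<in> {(i + k) mod n |k. k < (j + n - i) mod n} \<longleftrightarrow>
    (if i < j then i \<le> a \<and> a < j else i \<le> a \<or> a < j)"
proof (cases "i < j")
  case True
  then have "(j + n - i) mod n = j - i"
    using assms mod_add_self2[of "j - i" n] by simp
  moreover have "(i + k) mod n = i + k" if "k < j - i" for k using that assms by simp
  ultimately have "{(i + k) mod n |k. k < (j + n - i) mod n} = {i + k |k. k < j - i}"
    by force
  also have "a \<in> \<dots> \<longleftrightarrow> i \<le> a \<and> a < j"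
    by (auto intro!: exI[of _ "a - i"])
  finally show ?thesis using True by simp
next
  case False
  then have l: "(j + n - i) mod n = j + n - i" using assms by simp
  have wrap: "(i + k) mod n = (if i + k < n then i + k else i + k - n)" if "k < j + n - i" for k
    using that assms by (simp add: mod_if)
  have "a \<in> {(i + k) mod n |k. k < j + n - i} \<longleftrightarrow> i \<le> a \<or> a < j"
  proof
    assume "a \<in> {(i + k) mod n |k. k < j + n - i}"
    then obtain k where "k < j + n - i" "a = (i + k) mod n" by blast
    then show "i \<le> a \<or> a < j" using wrap[of k] by (auto split: if_splits)
  next
    assume "i \<le> a \<or> a < j"
    then have "\<exists>k < j + n - i. a = (i + k) mod n"
    proof
      assume "i \<le> a"
      then show ?thesis using assms wrap[of "a - i"] by (intro exI[of _ "a - i"]) auto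
    next
      assume "a < j"
      then show ?thesis using assms False wrap[of "a + n - i"] by (intro exI[of _ "a + n - i"]) auto
    qed
    then show "a \<in> {(i + k) mod n |k. k < j + n - i}" by blast
  qed
  then show ?thesis using False l by simp
qed

lemma pos_nth: "distinct (code D) \<Longrightarrow> i < length (code D) \<Longrightarrow> pos D (code D ! i) = i"
  unfolding pos_def by (rule the_equality) (auto simp: nth_eq_iff_index_eq)

lemma pos_less:
  assumes "distinct (code D)" "x \<in> set (code D)"
  shows "pos D x < length (code D)" "code D ! pos D x = x"
  using assms pos_nth[of D] by (metis in_set_conv_nth)+

lemma right_half_iff:
  assumes D: "wf_diagram D" and v: "v \<in> crossings D" and a: "a < length (code D)"
  shows "a \<in> right_half D v \<longleftrightarrow> (if pos D (v, SWNE) < pos D (v, SENW)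
     then pos D (v, SWNE) \<le> a \<and> a < pos D (v, SENW) else pos D (v, SWNE) \<le> a \<or> a < pos D (v, SENW))"
proof -
  have d: "distinct (code D)" using D by (simp add: wf_diagram_iff)
  have m: "(v, t) \<in> set (code D)" for t using wf_passages[OF D] v by simp
  have "pos D (v, SWNE) \<noteq> pos D (v, SENW)"
    using pos_less(2)[OF d m[of SWNE]] pos_less(2)[OF d m[of SENW]] by auto
  then show ?thesis
    unfolding right_half_def Let_def
    using cyclic_interval[OF pos_less(1)[OF d m] pos_less(1)[OF d m] _ a] by blast
qed

lemma right_half_arcs:
  assumes "wf_diagram D" "v \<in> crossings D"
  shows "right_half D v \<subseteq> arcs D"
proof -
  have "(v, SWNE) \<in> set (code D)" using wf_passages[OF assms(1)] assms(2) by simp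
  then have "length (code D) > 0" by (cases "code D") auto
  then have "a mod length (code D) < max 1 (length (code D))" for a
    using mod_less_divisor[of "length (code D)" a] by linarith
  then show ?thesis by (auto simp: right_half_def Let_def arcs_def)
qed

text \<open>
  The right half at \<open>v\<close> begins with the arc leaving \<open>v\<close> on the SW-NE strand and ends with the one entering
  \<open>v\<close> on the SE-NW strand; it is not left or entered elsewhere.
\<close>

lemma right_half_step:
  assumes D: "wf_diagram D" and i: "Suc i < length (code D)" and c: "code D ! Suc i = (v, s)" and u: "u \<in> crossings D"
  shows "u \<noteq> v \<Longrightarrow> Suc i \<in> right_half D u \<longleftrightarrow> i \<in> right_half D u"
    and "s = SWNE \<Longrightarrow> Suc i \<in> right_half D v \<and> i \<notin> right_half D v"
    and "s = SENW \<Longrightarrow> Suc i \<notin> right_half D v \<and> i \<in> right_half D v"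
proof -
  have d: "distinct (code D)" using D by (simp add: wf_diagram_iff)
  have pv: "pos D (v, s) = Suc i" using pos_nth[OF d i] c by simp
  have v: "v \<in> crossings D" using c i code_crossings by (metis nth_mem)
  have m: "(w, t) \<in> set (code D)" if "w \<in> crossings D" for w t using wf_passages[OF D] that by simp
  have i': "i < length (code D)" using i by simp
  have ne: "pos D (v, other s) \<noteq> Suc i"
    using pos_less(2)[OF d m[OF v, of "other s"]] c by auto
  show "Suc i \<in> right_half D u \<longleftrightarrow> i \<in> right_half D u" if "u \<noteq> v"
  proof -
    have "pos D (u, t) \<noteq> Suc i" for t
      using pos_less(2)[OF d m[OF u, of t]] c that by auto
    from this[of SWNE] this[of SENW] show ?thesis
      unfolding right_half_iff[OF D u i] right_half_iff[OF D u i'] by auto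
  qed
  show "Suc i \<in> right_half D v \<and> i \<notin> right_half D v" if "s = SWNE"
    using pv ne that unfolding right_half_iff[OF D v i] right_half_iff[OF D v i'] by auto
  show "Suc i \<notin> right_half D v \<and> i \<in> right_half D v" if "s = SENW"
    using pv ne that unfolding right_half_iff[OF D v i] right_half_iff[OF D v i'] by auto
qed

context parity
begin

text \<open>
  The candidate for \<open>\<rho>(D)\<close>, as a function of the arc.
\<close>

definition remainder :: "diagram \<Rightarrow> 'a chain" where
  "remainder D a = parity_cycle p D a - (\<Sum>v \<in> crossings D. times_chain (pi_of p D v) (right_half D v) a)"

text \<open>
  Passing through \<open>v\<close>, the coefficient of the parity cycle jumps by \<open>\<pi> v\<close> on the SW-NE strand and by
  \<open>- \<pi> v\<close> on the SE-NW strand, and of all the right halves only that of \<open>v\<close> jumps, in the same way.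
\<close>

lemma remainder_step:
  assumes D: "D \<in> K" and i: "Suc i < length (code D)"
  shows "remainder D (Suc i) = remainder D i"
proof -
  note wf = knot_wf[OF D]
  have d: "distinct (code D)" using wf by (simp add: wf_diagram_iff)
  obtain v s where vs: "code D ! Suc i = (v, s)" by (cases "code D ! Suc i")
  have v: "v \<in> crossings D" using vs i code_crossings by (metis nth_mem)
  let ?h = "\<lambda>u a. times_chain (pi_of p D u) (right_half D u) a"
  have "(\<Sum>u \<in> crossings D. ?h u (Suc i)) - (\<Sum>u \<in> crossings D. ?h u i) =
      (\<Sum>u \<in> crossings D. ?h u (Suc i) - ?h u i)"
    by (simp add: sum_subtractf)
  also have "\<dots> = (\<Sum>u \<in> crossings D. if u = v then ?h v (Suc i) - ?h v i else 0)"
    using right_half_step(1)[OF wf i vs] by (intro sum.cong) (auto simp: times_chain_def)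
  also have "\<dots> = ?h v (Suc i) - ?h v i"
    using v by (subst sum.delta) (auto simp: crossings_def)
  finally have sums: "(\<Sum>u \<in> crossings D. ?h u (Suc i)) - (\<Sum>u \<in> crossings D. ?h u i) = ?h v (Suc i) - ?h v i" .
  have c: "code D = take (Suc i) (code D) @ (v, s) # drop (Suc (Suc i)) (code D)"
    using i vs by (metis append_take_drop_id Cons_nth_drop_Suc)
  have "take (Suc i) (code D) \<noteq> []" using i by auto
  then have "before_arc D (v, s) = i" "after_arc D (v, s) = Suc i"
    using before_arc_eq[OF d c] after_arc_eq[OF d c] i by simp_all
  then have "before D (v, s) = parity_cycle p D i" "after D (v, s) = parity_cycle p D (Suc i)"
    by (simp_all add: before_def after_def)
  then have "pi_of p D v = (if s = SWNE then parity_cycle p D (Suc i) - parity_cycle p D i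
      else parity_cycle p D i - parity_cycle p D (Suc i))"
    using pi_strand[OF D v, of s] by (simp only:)
  then have "parity_cycle p D (Suc i) - parity_cycle p D i = ?h v (Suc i) - ?h v i"
    using right_half_step(2,3)[OF wf i vs v] by (cases s) (simp_all add: times_chain_def)
  then have "parity_cycle p D (Suc i) - parity_cycle p D i =
      (\<Sum>u \<in> crossings D. ?h u (Suc i)) - (\<Sum>u \<in> crossings D. ?h u i)"
    unfolding sums .
  then show ?thesis
    unfolding remainder_def by (simp add: algebra_simps)
qed

lemma remainder_const:
  assumes D: "D \<in> K" and "a \<in> arcs D"
  shows "remainder D a = remainder D 0"
proof -
  have "a < length (code D) \<Longrightarrow> remainder D a = remainder D 0"
    by (induction a) (use remainder_step[OF D] in auto)
  then show ?thesis using assms(2) by (cases "a = 0") (auto simp: arcs_def)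
qed

lemma parity_cycle_decomposition:
  assumes D: "D \<in> K"
  shows "parity_cycle p D = (\<lambda>a. (\<Sum>v \<in> crossings D. times_chain (pi_of p D v) (right_half D v) a)
     + times_chain \<rho> (arcs D) a) \<longleftrightarrow> \<rho> = remainder D 0" (is "_ = ?rhs \<rho> \<longleftrightarrow> _")
proof
  assume "parity_cycle p D = ?rhs \<rho>"
  then have "parity_cycle p D 0 = ?rhs \<rho> 0" by (rule fun_cong)
  then show "\<rho> = remainder D 0" by (simp add: remainder_def times_chain_def arcs_def)
next
  assume \<rho>: "\<rho> = remainder D 0"
  show "parity_cycle p D = ?rhs \<rho>"
  proof
    fix a
    show "parity_cycle p D a = ?rhs \<rho> a"
    proof (cases "a \<in> arcs D")
      case True
      then have "times_chain \<rho> (arcs D) a = remainder D a"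
        using remainder_const[OF D True] \<rho> by (simp add: times_chain_def)
      then show ?thesis by (simp add: remainder_def)
    next
      case False
      then have "times_chain (pi_of p D v) (right_half D v) a = 0" if "v \<in> crossings D" for v
        using right_half_arcs[OF knot_wf[OF D] that] by (auto simp: times_chain_def)
      then show ?thesis using False by (simp add: parity_cycle_def times_chain_def)
    qed
  qed
qed

lemma parity_cycle_H1:
  assumes "D \<in> K"
  shows "parity_cycle p D \<in> H1 D"
  unfolding H1_def
proof (intro CollectI conjI ballI)
  show "parity_cycle p D \<in> C1 D" by (simp add: C1_def parity_cycle_def)
  fix v assume "v \<in> crossings D"
  from conservation[OF assms this, of SWNE]
  show "parity_cycle p D (leg_arc D v SW) + parity_cycle p D (leg_arc D v SE) =
      parity_cycle p D (leg_arc D v NW) + parity_cycle p D (leg_arc D v NE)"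
    by (simp add: before_def after_def leg_arc_before_after add.commute)
qed

end

theorem theorem3:
  fixes K :: "diagram set" and p :: "diagram \<Rightarrow> nat \<Rightarrow> 'a::ab_group_add"
  assumes "virtual_knot K" and "oriented_parity K p"
  shows "(\<forall>D \<in> K. \<forall>v \<in> crossings D.
            pi_of p D v = parity_cycle p D (leg_arc D v SE) - parity_cycle p D (leg_arc D v NW)) \<and>
         quasi_index K (pi_of p) \<and>
         (\<forall>D \<in> K. parity_cycle p D \<in> H1 D \<and>
            (\<exists>!\<rho>. parity_cycle p D =
               (\<lambda>a. (\<Sum>v \<in> crossings D. times_chain (pi_of p D v) (right_half D v) a)
                     + times_chain \<rho> (arcs D) a)))"
proof -
  interpret parity K p by standard (rule assms)+
  have "pi_of p D v = parity_cycle p D (leg_arc D v SE) - parity_cycle p D (leg_arc D v NW)"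
    if "D \<in> K" "v \<in> crossings D" for D v
    using pi_in[OF that] by (simp add: before_def after_def leg_arc_before_after)
  moreover have "\<exists>!\<rho>. parity_cycle p D =
      (\<lambda>a. (\<Sum>v \<in> crossings D. times_chain (pi_of p D v) (right_half D v) a) + times_chain \<rho> (arcs D) a)"
    if "D \<in> K" for D
    unfolding parity_cycle_decomposition[OF that] by simp
  ultimately show ?thesis
    using pi_quasi_index parity_cycle_H1 by blast
qed

end
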